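(* Let $(M_j)_{j\ge 1}$ be a sequence of positive real numbers and $(k_j)_{j\ge 1}$ a sequence of positive integers such that (i) for all $\alpha\ge 1$, $j^\alpha=o(M_j)$ as $j\to+\infty$; (ii) for all $j\ge 1$, $M_j\ge j+1$; (iii) for all $j\ge 1$, $k_j\ge j+2$; (iv) $M_1<k_1$ and $k_j\ge k_1$ for all $j\ge 1$. Then a typical operator $T\in(\mathcal{L}_{(M_j),(k_j)},\mathrm{SOT})$ admits a hypercyclic algebra.
   Context: $H(\mathbb{C})$ denotes the algebra (with pointwise product) of entire functions on $\mathbb{C}$, endowed with the topology of uniform convergence on compact sets. For $f(z)=\sum_{m\ge 0}a_m z^m$ in $H(\mathbb{C})$ and an integer $j\ge 1$, put $N_j(f)=\sum_{m\ge 0}|a_m|j^m$; the semi-norms $(N_j)_{j\ge 1}$ define the topology of $H(\mathbb{C})$. Let $\mathcal{L}_{(M_j),(k_j)}$ be the set of all continuous linear operators $T:H(\mathbb{C})\to H(\mathbb{C})$ such that $N_j(Tf)\le M_j N_{k_j}(f)$ for all $j\ge1$ and all $f\in H(\mathbb{C})$. SOT is the topology of pointwise convergence on $H(\mathbb{C})$; $(\mathcal{L}_{(M_j),(k_j)},\mathrm{SOT})$ is a Polish space. A property is typical in a Polish space $E$ (a typical $x\in E$ has it) if the set of $x\in E$ having it is comeager in $E$, i.e. contains a dense $G_\delta$ subset of $E$. A vector $x$ is hypercyclic for a continuous operator $T$ on $X$ if $\{T^n x: n\ge 0\}$ is dense in $X$; $\mathrm{HC}(T)$ is the set of hypercyclic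 vectors for $T$. When $X$ is a topological algebra, $T$ admits a hypercyclic algebra if $\mathrm{HC}(T)\cup\{0\}$ contains a non-trivial (i.e. $\neq\{0\}$) subalgebra of $X$. *)

theory Defs
  imports "HOL-Complex_Analysis.Complex_Analysis" "HOL-Library.Landau_Symbols"
begin

section \<open>The Fr\'echet algebra of entire functions\<close>

definition entire :: "(complex \<Rightarrow> complex) set" where
  "entire = {f. f holomorphic_on UNIV}"

text \<open>
  A set of entire functions is open if around each of its points \<open>f\<close> it contains a basic
  neighbourhood for uniform convergence on some compact set \<open>K\<close>.
\<close>

definition entire_open :: "(complex \<Rightarrow> complex) set \<Rightarrow> bool" where
  "entire_open U \<longleftrightarrow> U \<subseteq> entire \<and>
     (\<forall>f\<in>U. \<exists>K e. compact K \<and> e > 0 \<and> {g \<in> entire. \<forall>z\<in>K. dist (g z) (f z) < e} \<subseteq> U)"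

definition entire_topology :: "(complex \<Rightarrow> complex) topology" where
  "entire_topology = topology entire_open"

lemma istopology_entire_open: "istopology entire_open"
  unfolding istopology_def
proof (intro conjI allI impI)
  fix S T assume S: "entire_open S" and T: "entire_open T"
  show "entire_open (S \<inter> T)"
    unfolding entire_open_def
  proof (intro conjI ballI)
    show "S \<inter> T \<subseteq> entire" using S by (auto simp: entire_open_def)
    fix f assume f: "f \<in> S \<inter> T"
    obtain K d where K: "compact K" "d > 0" "{g \<in> entire. \<forall>z\<in>K. dist (g z) (f z) < d} \<subseteq> S"
      using S f unfolding entire_open_def by blast
    obtain L e where L: "compact L" "e > 0" "{g \<in> entire. \<forall>z\<in>L. dist (g z) (f z) < e} \<subseteq> T"
      using T f unfolding entire_open_def by blast
    have "compact (K \<union> L)" "min d e > 0" using K L by auto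
    moreover have "{g \<in> entire. \<forall>z\<in>K \<union> L. dist (g z) (f z) < min d e} \<subseteq> S \<inter> T"
      using K(3) L(3) by auto
    ultimately show "\<exists>K e. compact K \<and> e > 0 \<and>
        {g \<in> entire. \<forall>z\<in>K. dist (g z) (f z) < e} \<subseteq> S \<inter> T" by blast
  qed
next
  fix \<U> assume U: "\<forall>S\<in>\<U>. entire_open S"
  show "entire_open (\<Union>\<U>)"
    unfolding entire_open_def
  proof (intro conjI ballI)
    show "\<Union>\<U> \<subseteq> entire" using U by (auto simp: entire_open_def)
    fix f assume "f \<in> \<Union>\<U>"
    then obtain S where "S \<in> \<U>" "f \<in> S" by blast
    with U obtain K e where "compact K" "e > 0" "{g \<in> entire. \<forall>z\<in>K. dist (g z) (f z) < e} \<subseteq> S"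
      unfolding entire_open_def by meson
    with \<open>S \<in> \<U>\<close> show "\<exists>K e. compact K \<and> e > 0 \<and>
        {g \<in> entire. \<forall>z\<in>K. dist (g z) (f z) < e} \<subseteq> \<Union>\<U>" by blast
  qed
qed

lemma openin_entire_topology: "openin entire_topology = entire_open"
  unfolding entire_topology_def by (rule topology_inverse'[OF istopology_entire_open])

lemma topspace_entire_topology [simp]: "topspace entire_topology = entire"
proof -
  have "entire_open entire"
    unfolding entire_open_def by (auto intro!: exI[of _ "{}"] exI[of _ "1::real"])
  then show ?thesis
    unfolding topspace_def openin_entire_topology using entire_open_def by blast
qed

text \<open>
  \<open>entire_seminorm j f\<close> is \<open>N\<^sub>j(f)\<close>; the coefficients of \<open>fps_expansion f 0\<close> are the Taylor
  coefficients of \<open>f\<close> at the origin, and the series converges for every entire \<open>f\<close>.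
\<close>

definition entire_seminorm :: "nat \<Rightarrow> (complex \<Rightarrow> complex) \<Rightarrow> real" where
  "entire_seminorm j f = (\<Sum>m. norm (fps_nth (fps_expansion f 0) m) * real j ^ m)"

text \<open>Subalgebras are not required to contain the constant function \<open>1\<close>.\<close>

definition entire_subalgebra :: "(complex \<Rightarrow> complex) set \<Rightarrow> bool" where
  "entire_subalgebra A \<longleftrightarrow> A \<subseteq> entire \<and> (\<lambda>z. 0) \<in> A \<and>
     (\<forall>f\<in>A. \<forall>g\<in>A. (\<lambda>z. f z + g z) \<in> A) \<and>
     (\<forall>c. \<forall>f\<in>A. (\<lambda>z. c * f z) \<in> A) \<and>
     (\<forall>f\<in>A. \<forall>g\<in>A. (\<lambda>z. f z * g z) \<in> A)"

section \<open>Operators\<close>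

type_synonym operator = "(complex \<Rightarrow> complex) \<Rightarrow> (complex \<Rightarrow> complex)"

definition linear_on_entire :: "operator \<Rightarrow> bool" where
  "linear_on_entire T \<longleftrightarrow>
     (\<forall>f\<in>entire. \<forall>g\<in>entire. T (\<lambda>z. f z + g z) = (\<lambda>z. T f z + T g z)) \<and>
     (\<forall>c. \<forall>f\<in>entire. T (\<lambda>z. c * f z) = (\<lambda>z. c * T f z))"

text \<open>
  Operators are extensional, i.e. they take the value \<open>undefined\<close> outside \<open>entire\<close>, so that
  distinct elements of the set below are distinct maps on \<open>entire\<close>.
\<close>

definition operators :: "(nat \<Rightarrow> real) \<Rightarrow> (nat \<Rightarrow> nat) \<Rightarrow> operator set" where
  "operators M k = {T \<in> entire \<rightarrow>\<^sub>E entire.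
     linear_on_entire T \<and> continuous_map entire_topology entire_topology T \<and>
     (\<forall>j\<ge>1. \<forall>f\<in>entire. entire_seminorm j (T f) \<le> M j * entire_seminorm (k j) f)}"

definition SOT :: "operator topology" where
  "SOT = product_topology (\<lambda>_. entire_topology) entire"

definition operator_space :: "(nat \<Rightarrow> real) \<Rightarrow> (nat \<Rightarrow> nat) \<Rightarrow> operator topology" where
  "operator_space M k = subtopology SOT (operators M k)"

lemma topspace_operator_space [simp]: "topspace (operator_space M k) = operators M k"
  by (auto simp: operator_space_def SOT_def operators_def)

section \<open>Typical properties and hypercyclic algebras\<close>

definition comeager_in :: "'a topology \<Rightarrow> 'a set \<Rightarrow> bool" where
  "comeager_in X S \<longleftrightarrow> S \<subseteq> topspace X \<and>
     (\<exists>G. gdelta_in X G \<and> X closure_of G = topspace X \<and> G \<subseteq> S)"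

definition typical_in :: "'a topology \<Rightarrow> ('a \<Rightarrow> bool) \<Rightarrow> bool" where
  "typical_in X P \<longleftrightarrow> comeager_in X {x \<in> topspace X. P x}"

definition hypercyclic_vectors :: "'a topology \<Rightarrow> ('a \<Rightarrow> 'a) \<Rightarrow> 'a set" where
  "hypercyclic_vectors X T =
     {x \<in> topspace X. X closure_of (range (\<lambda>n. (T ^^ n) x)) = topspace X}"

definition admits_hypercyclic_algebra :: "operator \<Rightarrow> bool" where
  "admits_hypercyclic_algebra T \<longleftrightarrow>
     (\<exists>A. entire_subalgebra A \<and> A \<noteq> {\<lambda>z. 0} \<and>
          A \<subseteq> hypercyclic_vectors entire_topology T \<union> {\<lambda>z. 0})"

end

theory Submission
  imports Defs
begin

text \<open>
  A generic operator makes the function \<open>z\<close> generate a hypercyclic algebra. Its algebra consists of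
  the polynomials without constant term. If \<open>p\<close> is one of them, of degree \<open>m\<close> and with leading
  coefficient \<open>c\<close>, then \<open>T\<^sup>n p\<close> is close to \<open>c * v\<close> as soon as \<open>T\<^sup>n\<close> sends \<open>z\<^sup>i\<close> close to \<open>0\<close> for
  \<open>1 \<le> i < m\<close> and \<open>z\<^sup>m\<close> close to \<open>v\<close>. So it suffices that for every \<open>m\<close>, every target \<open>v\<close> in a
  countable dense set and every precision some iterate of \<open>T\<close> does this
  (\<open>hypercyclic_algebra_if_hitting\<close>). These are countably many conditions, each of them open in
  \<open>T\<close>, and Baire's theorem reduces the claim to the density of each.

  The bounds \<open>N\<^sub>j(T f) \<le> M\<^sub>j N\<^bsub>k\<^sub>j\<^esub>(f)\<close> need only be checked on monomials, since \<open>N\<^sub>j\<close> is a weighted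
  \<open>\<ell>\<^sup>1\<close>-norm. The operators therefore correspond to the matrices whose row \<open>q\<close>, the Taylor
  coefficients of \<open>T z\<^sup>q\<close>, satisfies \<open>N\<^sub>j \<le> M\<^sub>j k\<^sub>j\<^sup>q\<close> for all \<open>j\<close>. This set of matrices is closed for
  entrywise convergence, which corresponds to the strong operator topology
  (\<open>continuous_map_operator_of\<close>, \<open>continuous_map_matrix_of\<close>). The rows can be chosen independently
  of each other, and neighbourhoods restrict only finitely many entries.

  For density, let \<open>A\<close> be \<open>1 - \<epsilon>\<close> times the upper left \<open>(D + 1) \<times> (D + 1)\<close> corner of a given matrix.
  Perturbing it to \<open>T p = A p + \<delta> z\<^sup>a p\<close> on the polynomials \<open>p\<close> of degree at most \<open>D\<close> is invisible in
  that corner, and the rows beyond it are free. They are used to carry the copy \<open>\<delta> z\<^sup>a p\<close> up along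
  degrees \<open>a + i d\<close> while undoing the copies that \<open>T\<close> makes of \<open>A p, A\<^sup>2 p, \<dots>\<close>:
  \<open>T (z\<^bsup>a + i d\<^esup> p) = z\<^bsup>a + (i + 1) d\<^esup> p - z\<^sup>a A\<^bsup>i + 1\<^esup> p\<close>. Then
  \<open>T\<^bsup>i + 1\<^esup> p = A\<^bsup>i + 1\<^esup> p + \<delta> z\<^bsup>a + i d\<^esup> p\<close>. A row of high index \<open>q\<close> may have norm up to \<open>M\<^sub>j k\<^sub>j\<^sup>q\<close>, and
  \<open>k\<^sub>j \<ge> 3\<close>; if \<open>3\<^sup>d \<ge> 2 K\<close>, where \<open>K\<close> bounds the norm of \<open>A\<close>, then for large \<open>R\<close> this permitted norm
  at \<open>q = a + R d\<close> has overtaken \<open>K\<^bsup>R + 2\<^esup> / \<delta>\<close>. One last row can then send \<open>\<delta> z\<^bsup>a + R d\<^esup> p\<close> to any prescribed target minus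
  \<open>A\<^bsup>R + 2\<^esup> p\<close>, up to the usual correction, so that \<open>T\<^bsup>R + 2\<^esup>\<close> maps \<open>1, z, \<dots>, z\<^sup>D\<close>
  to arbitrary prescribed polynomials of degree at most \<open>D\<close> (\<open>ex_matrix_steering_monomials\<close>). The jump from degree \<open>a + i d\<close> to
  \<open>a + (i + 1) d\<close> costs a factor \<open>j\<^sup>d\<close>, which \<open>M\<^sub>j\<close> pays for when \<open>j\<close> is large, by the growth condition, and
  \<open>(k\<^sub>j / j)\<^sup>a\<close> when \<open>j\<close> is small, because \<open>k\<^sub>j \<ge> j + 2\<close> and \<open>a\<close> may be chosen large.
\<close>

section \<open>Taylor coefficients and the seminorms\<close>

abbreviation N :: "nat \<Rightarrow> (complex \<Rightarrow> complex) \<Rightarrow> real" where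
  "N \<equiv> entire_seminorm"

abbreviation taylor :: "(complex \<Rightarrow> complex) \<Rightarrow> nat \<Rightarrow> complex" where
  "taylor f l \<equiv> fps_nth (fps_expansion f 0) l"

lemma N_eq: "N j f = (\<Sum>l. norm (taylor f l) * real j ^ l)"
  by (simp add: entire_seminorm_def)

lemma entire_has_fps_expansion: "f \<in> entire \<Longrightarrow> f has_fps_expansion fps_expansion f 0"
  using holomorphic_on_imp_analytic_at[of f UNIV 0]
  by (auto intro: analytic_at_imp_has_fps_expansion_0 simp: entire_def)

lemma taylor_conv_radius: "f \<in> entire \<Longrightarrow> fps_conv_radius (fps_expansion f 0) = \<infinity>"
  using conv_radius_fps_expansion[of f 0 \<infinity>] by (simp add: entire_def)

lemma summable_taylor:
  assumes "f \<in> entire"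
  shows "summable (\<lambda>l. norm (taylor f l) * real j ^ l)"
proof -
  have "summable (\<lambda>l. norm (taylor f l * (of_nat j) ^ l))"
    by (rule abs_summable_in_conv_radius)
       (use taylor_conv_radius[OF assms] in \<open>simp add: fps_conv_radius_def\<close>)
  then show ?thesis by (simp add: norm_mult norm_power)
qed

lemma taylor_sums: "f \<in> entire \<Longrightarrow> (\<lambda>l. taylor f l * z ^ l) sums f z"
  by (rule has_fps_expansion_imp_sums_complex[of _ _ \<infinity>])
     (auto intro: entire_has_fps_expansion simp: entire_def)

lemma taylor_unique:
  assumes "f \<in> entire" "g \<in> entire" "\<And>l. taylor f l = taylor g l"
  shows "f = g"
proof
  fix z show "f z = g z"
    using taylor_sums[OF assms(1), of z] taylor_sums[OF assms(2), of z] assms(3)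
    by (simp add: sums_iff)
qed

definition power_series :: "(nat \<Rightarrow> complex) \<Rightarrow> complex \<Rightarrow> complex" where
  "power_series a z = (\<Sum>l. a l * z ^ l)"

lemma
  assumes "\<And>j. j \<ge> 1 \<Longrightarrow> summable (\<lambda>l. norm (a l) * real j ^ l)"
  shows power_series_entire: "power_series a \<in> entire"
    and taylor_power_series: "taylor (power_series a) l = a l"
proof -
  have eq: "power_series a = eval_fps (Abs_fps a)"
    by (simp add: fun_eq_iff power_series_def eval_fps_def)
  have "conv_radius a \<ge> real (Suc j)" for j
  proof -
    have "summable (\<lambda>l. norm (a l * of_nat (Suc j) ^ l))"
      using assms[of "Suc j"] by (simp only: norm_mult norm_power norm_of_nat)
    from conv_radius_geI[OF summable_norm_cancel[OF this]] show ?thesis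
      by (simp only: norm_of_nat)
  qed
  then have "conv_radius a = \<infinity>"
    by (metis ereal_less_eq(3) less_PInf_Ex_of_nat linorder_not_le nle_le not_less_eq_eq of_nat_le_iff
        order_trans)
  then have "fps_conv_radius (Abs_fps a) = \<infinity>"
    by (simp add: fps_conv_radius_def)
  then show "power_series a \<in> entire" "taylor (power_series a) l = a l"
    unfolding eq entire_def
    by (auto intro!: holomorphic_intros simp: fps_expansion_eqI[OF eval_fps_has_fps_expansion])
qed

lemma entire_add [intro]: "f \<in> entire \<Longrightarrow> g \<in> entire \<Longrightarrow> (\<lambda>z. f z + g z) \<in> entire"
  and entire_diff [intro]: "f \<in> entire \<Longrightarrow> g \<in> entire \<Longrightarrow> (\<lambda>z. f z - g z) \<in> entire"
  and entire_cmult [intro]: "f \<in> entire \<Longrightarrow> (\<lambda>z. c * f z) \<in> entire"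
  and entire_poly [intro, simp]: "poly p \<in> entire"
  and entire_const [intro, simp]: "(\<lambda>z. c) \<in> entire"
  and entire_power [intro, simp]: "(\<lambda>z. z ^ n) \<in> entire"
  by (auto simp: entire_def intro!: holomorphic_intros)

lemma entire_sum [intro]: "(\<And>i. i \<in> I \<Longrightarrow> f i \<in> entire) \<Longrightarrow> (\<lambda>z. \<Sum>i\<in>I. f i z) \<in> entire"
  by (auto simp: entire_def intro!: holomorphic_intros)

lemma taylor_add:
  "f \<in> entire \<Longrightarrow> g \<in> entire \<Longrightarrow> taylor (\<lambda>z. f z + g z) l = taylor f l + taylor g l"
  by (subst fps_expansion_eqI[OF has_fps_expansion_add]) (auto intro: entire_has_fps_expansion)

lemma taylor_diff:
  "f \<in> entire \<Longrightarrow> g \<in> entire \<Longrightarrow> taylor (\<lambda>z. f z - g z) l = taylor f l - taylor g l"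
  by (subst fps_expansion_eqI[OF has_fps_expansion_diff]) (auto intro: entire_has_fps_expansion)

lemma taylor_cmult: "f \<in> entire \<Longrightarrow> taylor (\<lambda>z. c * f z) l = c * taylor f l"
  by (subst fps_expansion_eqI[OF has_fps_expansion_cmult_left]) (auto intro: entire_has_fps_expansion)

lemma taylor_poly: "taylor (poly p) l = coeff p l"
proof -
  have "poly p has_fps_expansion fps_of_poly p"
    using eval_fps_has_fps_expansion[of "fps_of_poly p"] by (simp add: eval_fps_of_poly[abs_def])
  then show ?thesis by (simp add: fps_expansion_eqI)
qed

lemma N_nonneg: "f \<in> entire \<Longrightarrow> N j f \<ge> 0"
  unfolding N_eq by (intro suminf_nonneg summable_taylor) auto

lemma N_add: "f \<in> entire \<Longrightarrow> g \<in> entire \<Longrightarrow> N j (\<lambda>z. f z + g z) \<le> N j f + N j g"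
  unfolding N_eq
  by (subst suminf_add; (intro suminf_le summable_taylor summable_add entire_add)?)
     (auto simp: taylor_add distrib_right[symmetric] intro!: mult_right_mono norm_triangle_ineq)

lemma N_cmult: "f \<in> entire \<Longrightarrow> N j (\<lambda>z. c * f z) = norm c * N j f"
  unfolding N_eq by (simp add: suminf_mult[symmetric] summable_taylor taylor_cmult norm_mult mult.assoc)

lemma N_zero [simp]: "N j (\<lambda>z. 0) = 0"
  using N_cmult[of "\<lambda>z. 0" j 0] by (simp add: entire_def)

lemma N_diff: "f \<in> entire \<Longrightarrow> g \<in> entire \<Longrightarrow> N j (\<lambda>z. f z - g z) \<le> N j f + N j g"
  using N_add[of f "\<lambda>z. -1 * g z" j] N_cmult[of g j "-1"] entire_cmult[of g "-1"] by simp

lemma N_diff_triangle: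
  assumes "f \<in> entire" "g \<in> entire" "h \<in> entire"
  shows "N j (\<lambda>z. f z - h z) \<le> N j (\<lambda>z. f z - g z) + N j (\<lambda>z. g z - h z)"
  using N_add[of "\<lambda>z. f z - g z" "\<lambda>z. g z - h z" j] assms by (simp add: entire_diff)

lemma N_sum:
  "finite I \<Longrightarrow> (\<And>i. i \<in> I \<Longrightarrow> f i \<in> entire) \<Longrightarrow> N j (\<lambda>z. \<Sum>i\<in>I. f i z) \<le> (\<Sum>i\<in>I. N j (f i))"
proof (induction I rule: finite_induct)
  case (insert x I)
  then show ?case
    using N_add[of "f x" "\<lambda>z. \<Sum>i\<in>I. f i z" j] by (auto simp: entire_sum)
qed auto

lemma N_mono:
  assumes "f \<in> entire" "i \<le> j" shows "N i f \<le> N j f"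
  unfolding N_eq using assms
  by (intro suminf_le summable_taylor) (auto intro!: mult_left_mono power_mono)

lemma taylor_le_N:
  assumes "f \<in> entire" "j \<ge> 1" shows "norm (taylor f l) \<le> N j f"
proof -
  have "norm (taylor f l) * 1 \<le> norm (taylor f l) * real j ^ l"
    using assms by (intro mult_left_mono) auto
  also have "\<dots> \<le> N j f"
    unfolding N_eq using sum_le_suminf[OF summable_taylor[OF assms(1), of j], of "{l}"] by simp
  finally show ?thesis by simp
qed

lemma norm_le_N:
  assumes "f \<in> entire" "norm z \<le> real j" shows "norm (f z) \<le> N j f"
proof -
  have le: "norm (taylor f l * z ^ l) \<le> norm (taylor f l) * real j ^ l" for l
    using assms by (auto simp: norm_mult norm_power intro!: mult_left_mono power_mono)
  have s: "summable (\<lambda>l. norm (taylor f l * z ^ l))"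
    by (rule summable_comparison_test'[OF summable_taylor[OF assms(1), of j], of 0]) (use le in simp)
  have "norm (f z) = norm (\<Sum>l. taylor f l * z ^ l)"
    using taylor_sums[OF assms(1)] by (simp add: sums_iff)
  also have "\<dots> \<le> (\<Sum>l. norm (taylor f l * z ^ l))"
    by (rule summable_norm[OF s])
  also have "\<dots> \<le> N j f"
    unfolding N_eq by (intro suminf_le s summable_taylor assms le)
  finally show ?thesis .
qed

text \<open>Cauchy's inequalities on the circle of radius \<open>2 j\<close> bound the series \<open>N\<^sub>j\<close> by a geometric one.\<close>

lemma N_le_sup_norm:
  assumes f: "f \<in> entire" and j: "j \<ge> 1"
    and B: "\<And>z. norm z \<le> 2 * real j \<Longrightarrow> norm (f z) \<le> B"
  shows "N j f \<le> 2 * B"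
proof -
  have le: "norm (taylor f l) * real j ^ l \<le> B * (1 / 2) ^ l" for l
  proof -
    have "norm ((deriv ^^ l) f 0) \<le> fact l * B / (2 * real j) ^ l"
      using f j by (intro Cauchy_inequality B)
        (auto simp: entire_def intro: holomorphic_on_subset intro!: holomorphic_on_imp_continuous_on)
    then have "norm (taylor f l) \<le> B / (2 * real j) ^ l"
      by (simp add: fps_expansion_def norm_divide field_simps)
    then show ?thesis using j by (simp add: field_simps power_mult_distrib)
  qed
  have "N j f \<le> (\<Sum>l. B * (1 / 2) ^ l)"
    unfolding N_eq by (intro suminf_le summable_taylor f le summable_mult summable_geometric) auto
  also have "\<dots> = 2 * B"
    by (subst suminf_mult) (auto simp: suminf_geometric intro!: summable_geometric)
  finally show ?thesis .
qed

text \<open>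
  A compact set lies in some disc of radius \<open>j\<close>, on which \<open>N\<^sub>j\<close> dominates the supremum norm.
  Conversely the supremum over the disc of radius \<open>2 j\<close> controls \<open>N\<^sub>j\<close>.
\<close>

lemma openin_entire_iff:
  "openin entire_topology U \<longleftrightarrow> U \<subseteq> entire \<and>
     (\<forall>f\<in>U. \<exists>j e. j \<ge> 1 \<and> e > 0 \<and> {g \<in> entire. N j (\<lambda>z. g z - f z) < e} \<subseteq> U)"
  unfolding openin_entire_topology entire_open_def
proof (intro conj_cong refl ball_cong iffI; elim exE conjE)
  fix f K and e :: real
  assume U: "U \<subseteq> entire" "f \<in> U" and K: "compact K" "e > 0" "{g \<in> entire. \<forall>z\<in>K. dist (g z) (f z) < e} \<subseteq> U"
  obtain B where B: "\<And>z. z \<in> K \<Longrightarrow> norm z \<le> B"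
    using compact_imp_bounded[OF K(1)] unfolding bounded_iff by blast
  obtain j where j: "B \<le> real j" using real_arch_simple by blast
  have "{g \<in> entire. N (Suc j) (\<lambda>z. g z - f z) < e} \<subseteq> U"
  proof (intro subsetI)
    fix g assume "g \<in> {g \<in> entire. N (Suc j) (\<lambda>z. g z - f z) < e}"
    then have g: "g \<in> entire" "N (Suc j) (\<lambda>z. g z - f z) < e" by auto
    have "dist (g z) (f z) < e" if "z \<in> K" for z
      using norm_le_N[of "\<lambda>z. g z - f z" z "Suc j"] B[OF that] j g U
      by (force simp: dist_norm entire_diff)
    then show "g \<in> U" using K(3) g by auto
  qed
  then show "\<exists>j e. j \<ge> 1 \<and> e > 0 \<and> {g \<in> entire. N j (\<lambda>z. g z - f z) < e} \<subseteq> U"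
    using K(2) by (intro exI[of _ "Suc j"] exI[of _ e]) auto
next
  fix f j and e :: real
  assume U: "U \<subseteq> entire" "f \<in> U" and j: "j \<ge> 1" "e > 0" "{g \<in> entire. N j (\<lambda>z. g z - f z) < e} \<subseteq> U"
  have "{g \<in> entire. \<forall>z\<in>cball 0 (2 * real j). dist (g z) (f z) < e / 3} \<subseteq> U"
  proof (intro subsetI)
    fix g assume "g \<in> {g \<in> entire. \<forall>z\<in>cball 0 (2 * real j). dist (g z) (f z) < e / 3}"
    then have g: "g \<in> entire" "\<And>z. norm z \<le> 2 * real j \<Longrightarrow> norm (g z - f z) < e / 3"
      by (auto simp: dist_norm)
    have "N j (\<lambda>z. g z - f z) \<le> 2 * (e / 3)"
      using g U j(1) by (intro N_le_sup_norm) (auto intro: less_imp_le)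
    then show "g \<in> U" using j g by auto
  qed
  then show "\<exists>K e. compact K \<and> e > 0 \<and> {g \<in> entire. \<forall>z\<in>K. dist (g z) (f z) < e} \<subseteq> U"
    using j(2) by (intro exI[of _ "cball 0 (2 * real j)"] exI[of _ "e / 3"]) auto
qed

lemma openin_N_ball:
  assumes "f \<in> entire" "j \<ge> 1"
  shows "openin entire_topology {g \<in> entire. N j (\<lambda>z. g z - f z) < e}"
  unfolding openin_entire_iff
proof (intro conjI ballI)
  fix g assume "g \<in> {g \<in> entire. N j (\<lambda>z. g z - f z) < e}"
  then have g: "g \<in> entire" "N j (\<lambda>z. g z - f z) < e" by auto
  have "{h \<in> entire. N j (\<lambda>z. h z - g z) < e - N j (\<lambda>z. g z - f z)}
      \<subseteq> {g \<in> entire. N j (\<lambda>z. g z - f z) < e}"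
    using N_diff_triangle[OF _ g(1) assms(1), of _ j] by (auto simp: field_simps) (smt (verit))
  then show "\<exists>i d. i \<ge> 1 \<and> d > 0 \<and> {h \<in> entire. N i (\<lambda>z. h z - g z) < d}
      \<subseteq> {g \<in> entire. N j (\<lambda>z. g z - f z) < e}"
    using g assms by (intro exI[of _ j] exI[of _ "e - N j (\<lambda>z. g z - f z)"]) auto
qed auto

lemma closure_of_entire_eqI:
  assumes "A \<subseteq> entire"
    and "\<And>f j e. f \<in> entire \<Longrightarrow> j \<ge> 1 \<Longrightarrow> e > 0 \<Longrightarrow> \<exists>g\<in>A. N j (\<lambda>z. g z - f z) < e"
  shows "entire_topology closure_of A = topspace entire_topology"
  unfolding dense_intersects_open
proof (intro allI impI)
  fix U assume "openin entire_topology U \<and> U \<noteq> {}"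
  then obtain f where f: "f \<in> U" and U: "openin entire_topology U" by blast
  from U f obtain j e where je: "j \<ge> 1" "e > 0" "{g \<in> entire. N j (\<lambda>z. g z - f z) < e} \<subseteq> U"
    and "f \<in> entire" unfolding openin_entire_iff by blast
  from assms(2)[OF \<open>f \<in> entire\<close> je(1,2)] obtain g where "g \<in> A" "N j (\<lambda>z. g z - f z) < e" by blast
  then show "A \<inter> U \<noteq> {}" using je(3) assms(1) by blast
qed

lemma taylor_zero [simp]: "taylor (\<lambda>z. 0) l = 0"
  using taylor_cmult[of "\<lambda>z. 0" 0 l] by simp

lemma taylor_monomial: "taylor (\<lambda>z. z ^ q) l = (if l = q then 1 else 0)"
proof -
  have "(\<lambda>z::complex. z ^ q) = poly (monom 1 q)" by (simp add: fun_eq_iff poly_monom)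
  then show ?thesis by (simp only: taylor_poly) simp
qed

lemma N_monomial: "N j (\<lambda>z. z ^ q) = real j ^ q"
proof -
  have "(\<lambda>l. norm (taylor (\<lambda>z. z ^ q) l) * real j ^ l) = (\<lambda>l. if l = q then real j ^ l else 0)"
    by (auto simp: taylor_monomial)
  then show ?thesis by (simp add: N_eq sums_unique[OF sums_single, symmetric])
qed

text \<open>On sets that are bounded for all seminorms, coefficientwise convergence is convergence:
  a bound for \<open>N\<^sub>2\<^sub>j\<close> dominates the series \<open>N\<^sub>j\<close> by a geometric one.\<close>

lemma N_tendsto_0:
  assumes ent: "\<And>s. g s \<in> entire" and bound: "\<And>s j. j \<ge> 1 \<Longrightarrow> N j (g s) \<le> B j"
    and lim: "\<And>l. (\<lambda>s. taylor (g s) l) \<longlonglongrightarrow> 0" and j: "j \<ge> 1"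
  shows "(\<lambda>s. N j (g s)) \<longlonglongrightarrow> 0"
proof -
  have dom: "norm (taylor (g s) l) * real j ^ l \<le> B (2 * j) * (1 / 2) ^ l" for s l
  proof -
    have "norm (taylor (g s) l) * real (2 * j) ^ l \<le> N (2 * j) (g s)"
      unfolding N_eq using sum_le_suminf[OF summable_taylor[OF ent, of s "2 * j"], of "{l}"] by simp
    also have "\<dots> \<le> B (2 * j)" using bound j by simp
    finally show ?thesis by (simp add: field_simps power_mult_distrib)
  qed
  have "(\<lambda>s. \<Sum>l. norm (taylor (g s) l) * real j ^ l) \<longlonglongrightarrow> (\<Sum>l. 0 * real j ^ l)"
  proof (rule conjunct2[OF conjunct2[OF tannerys_theorem]])
    show "(\<lambda>s. norm (taylor (g s) l) * real j ^ l) \<longlonglongrightarrow> 0 * real j ^ l" for l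
      by (intro tendsto_intros tendsto_norm_zero lim)
    show "\<forall>\<^sub>F (l, s) in sequentially \<times>\<^sub>F sequentially.
        norm (norm (taylor (g s) l) * real j ^ l) \<le> B (2 * j) * (1 / 2) ^ l"
      using dom by (intro always_eventually) simp
    show "summable (\<lambda>l. B (2 * j) * (1 / 2 :: real) ^ l)"
      by (intro summable_mult summable_geometric) simp
  qed simp
  then show ?thesis by (simp add: N_eq)
qed

lemma taylor_polynomial_tendsto:
  assumes f: "f \<in> entire" and j: "j \<ge> 1"
  shows "(\<lambda>Q. N j (\<lambda>z. f z - poly (\<Sum>q<Q. monom (taylor f q) q) z)) \<longlonglongrightarrow> 0"
proof (rule N_tendsto_0[OF _ _ _ j])
  have t: "taylor (poly (\<Sum>q<Q. monom (taylor f q) q)) l = (if l < Q then taylor f l else 0)" for Q l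
    by (simp add: taylor_poly coeff_sum)
  show "(\<lambda>z. f z - poly (\<Sum>q<Q. monom (taylor f q) q) z) \<in> entire" for Q using f by auto
  show "N j (\<lambda>z. f z - poly (\<Sum>q<Q. monom (taylor f q) q) z) \<le> N j f" for Q j
    unfolding N_eq using f
    by (intro suminf_le summable_taylor entire_diff mult_right_mono) (auto simp: taylor_diff t)
  show "(\<lambda>Q. taylor (\<lambda>z. f z - poly (\<Sum>q<Q. monom (taylor f q) q) z) l) \<longlonglongrightarrow> 0" for l
    by (rule tendsto_eventually)
       (use eventually_gt_at_top[of l] in eventually_elim, simp add: taylor_diff f t)
qed

section \<open>Operators as matrices\<close>

text \<open>
  Bounding partial sums, instead of the series, makes the set visibly closed for entrywise
  convergence and makes summability part of the condition.
\<close>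

definition matrices :: "(nat \<Rightarrow> real) \<Rightarrow> (nat \<Rightarrow> nat) \<Rightarrow> (nat \<Rightarrow> nat \<Rightarrow> complex) set" where
  "matrices M k = {c. \<forall>q j L. j \<ge> 1 \<longrightarrow> (\<Sum>l<L. norm (c q l) * real j ^ l) \<le> M j * real (k j) ^ q}"

text \<open>The restriction gives extensional operators, so that \<open>matrix_of\<close> below can be inverse to \<open>operator_of\<close>.\<close>

definition operator_of :: "(nat \<Rightarrow> nat \<Rightarrow> complex) \<Rightarrow> operator" where
  "operator_of c = restrict (\<lambda>f. power_series (\<lambda>l. \<Sum>q. taylor f q * c q l)) entire"

definition matrix_of :: "operator \<Rightarrow> nat \<Rightarrow> nat \<Rightarrow> complex" where
  "matrix_of T q l = taylor (T (\<lambda>z. z ^ q)) l"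

lemma matricesI:
  assumes "\<And>q. g q \<in> entire" "\<And>q j. j \<ge> 1 \<Longrightarrow> N j (g q) \<le> M j * real (k j) ^ q"
  shows "(\<lambda>q. taylor (g q)) \<in> matrices M k"
  unfolding matrices_def
proof (intro CollectI allI impI)
  fix q j L :: nat assume j: "j \<ge> 1"
  have "(\<Sum>l<L. norm (taylor (g q) l) * real j ^ l) \<le> N j (g q)"
    unfolding N_eq by (intro sum_le_suminf summable_taylor assms) auto
  with assms(2)[OF j, of q] show "(\<Sum>l<L. norm (taylor (g q) l) * real j ^ l) \<le> M j * real (k j) ^ q"
    by simp
qed

lemma matrices_entry_bound:
  assumes "c \<in> matrices M k" "j \<ge> 1"
  shows "norm (c q l) \<le> M j * real (k j) ^ q"
proof -
  have "norm (c q l) * 1 \<le> norm (c q l) * real j ^ l"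
    using assms by (intro mult_left_mono) auto
  also have "\<dots> \<le> (\<Sum>l<Suc l. norm (c q l) * real j ^ l)"
    by (rule member_le_sum) auto
  also have "\<dots> \<le> M j * real (k j) ^ q"
    using assms unfolding matrices_def by blast
  finally show ?thesis by simp
qed

lemma matrices_nonneg:
  assumes "c \<in> matrices M k" "j \<ge> 1" shows "M j \<ge> 0"
  using order_trans[OF norm_ge_zero matrices_entry_bound[OF assms, of 0 0]] by simp

lemma matrices_entry_summable:
  assumes "c \<in> matrices M k" "f \<in> entire"
  shows "summable (\<lambda>q. norm (taylor f q) * norm (c q l))"
proof (rule summable_comparison_test')
  show "summable (\<lambda>q. M 1 * (norm (taylor f q) * real (k 1) ^ q))"
    by (intro summable_mult summable_taylor assms)
  show "norm (norm (taylor f q) * norm (c q l)) \<le> M 1 * (norm (taylor f q) * real (k 1) ^ q)" for q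
    using mult_left_mono[OF matrices_entry_bound[OF assms(1), of 1 q l], of "norm (taylor f q)"]
    by (simp add: mult_ac)
qed

lemma matrices_entry_summable':
  assumes "c \<in> matrices M k" "f \<in> entire"
  shows "summable (\<lambda>q. taylor f q * c q l)"
  by (rule summable_norm_cancel) (use matrices_entry_summable[OF assms, of l] in \<open>simp add: norm_mult\<close>)

text \<open>
  Each row bound, weighted by the modulus of a Taylor coefficient of \<open>f\<close>, adds up to \<open>M\<^sub>j N\<^bsub>k\<^sub>j\<^esub>(f)\<close>.
  With partial sums on the left, only a finite sum has to be exchanged with a series.
\<close>

lemma operator_of_coeff_bound:
  assumes c: "c \<in> matrices M k" and f: "f \<in> entire" and j: "j \<ge> 1"
  shows "(\<Sum>l<L. norm (\<Sum>q. taylor f q * c q l) * real j ^ l) \<le> M j * N (k j) f"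
proof -
  note sm = matrices_entry_summable[OF c f]
  have "(\<Sum>l<L. norm (\<Sum>q. taylor f q * c q l) * real j ^ l)
      \<le> (\<Sum>l<L. (\<Sum>q. norm (taylor f q) * norm (c q l)) * real j ^ l)"
    using summable_norm[of "\<lambda>q. taylor f q * c q _"] sm
    by (intro sum_mono mult_right_mono) (auto simp: norm_mult)
  also have "\<dots> = (\<Sum>l<L. \<Sum>q. norm (taylor f q) * norm (c q l) * real j ^ l)"
    by (intro sum.cong refl suminf_mult2 sm)
  also have "\<dots> = (\<Sum>q. \<Sum>l<L. norm (taylor f q) * norm (c q l) * real j ^ l)"
    by (intro suminf_sum[symmetric] summable_mult2 sm)
  also have "\<dots> \<le> (\<Sum>q. M j * (norm (taylor f q) * real (k j) ^ q))"
  proof (intro suminf_le summable_sum summable_mult2 sm summable_mult summable_taylor f)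
    fix q
    have "(\<Sum>l<L. norm (c q l) * real j ^ l) \<le> M j * real (k j) ^ q"
      using c j unfolding matrices_def by blast
    from mult_left_mono[OF this, of "norm (taylor f q)"]
    show "(\<Sum>l<L. norm (taylor f q) * norm (c q l) * real j ^ l) \<le> M j * (norm (taylor f q) * real (k j) ^ q)"
      by (simp add: sum_distrib_left mult_ac)
  qed
  also have "\<dots> = M j * N (k j) f"
    unfolding N_eq by (intro suminf_mult summable_taylor f)
  finally show ?thesis .
qed

lemma
  assumes c: "c \<in> matrices M k" and f: "f \<in> entire"
  shows operator_of_entire: "operator_of c f \<in> entire"
    and taylor_operator_of: "taylor (operator_of c f) l = (\<Sum>q. taylor f q * c q l)"
    and N_operator_of: "j \<ge> 1 \<Longrightarrow> N j (operator_of c f) \<le> M j * N (k j) f"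
proof -
  have sm: "summable (\<lambda>l. norm (\<Sum>q. taylor f q * c q l) * real j ^ l)" if "j \<ge> 1" for j
    by (rule bounded_imp_summable[of _ "M j * N (k j) f"])
       (use operator_of_coeff_bound[OF c f that, of "Suc _"] in \<open>auto simp: lessThan_Suc_atMost\<close>)
  have eq: "operator_of c f = power_series (\<lambda>l. \<Sum>q. taylor f q * c q l)"
    using f by (simp add: operator_of_def)
  show "operator_of c f \<in> entire" unfolding eq by (intro power_series_entire sm)
  have t: "taylor (operator_of c f) l = (\<Sum>q. taylor f q * c q l)" for l
    unfolding eq by (intro taylor_power_series sm)
  then show "taylor (operator_of c f) l = (\<Sum>q. taylor f q * c q l)" .
  show "N j (operator_of c f) \<le> M j * N (k j) f" if "j \<ge> 1"
    unfolding N_eq[of j] t by (intro suminf_le_const sm that operator_of_coeff_bound c f)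
qed

lemma operator_of_add:
  assumes c: "c \<in> matrices M k" and f: "f \<in> entire" "g \<in> entire"
  shows "operator_of c (\<lambda>z. f z + g z) = (\<lambda>z. operator_of c f z + operator_of c g z)"
proof (rule taylor_unique)
  have "summable (\<lambda>q. taylor f q * c q l)" "summable (\<lambda>q. taylor g q * c q l)" for l
    by (rule matrices_entry_summable'[OF c], fact)+
  then show "taylor (operator_of c (\<lambda>z. f z + g z)) l
      = taylor (\<lambda>z. operator_of c f z + operator_of c g z) l" for l
    by (simp add: taylor_operator_of[OF c] taylor_add operator_of_entire[OF c] f entire_add
        suminf_add distrib_right)
qed (use assms in \<open>auto intro: operator_of_entire\<close>)

lemma operator_of_cmult:
  assumes c: "c \<in> matrices M k" and f: "f \<in> entire"
  shows "operator_of c (\<lambda>z. a * f z) = (\<lambda>z. a * operator_of c f z)"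
proof (rule taylor_unique)
  have "summable (\<lambda>q. taylor f q * c q l)" for l
    by (rule matrices_entry_summable'[OF c f])
  then show "taylor (operator_of c (\<lambda>z. a * f z)) l = taylor (\<lambda>z. a * operator_of c f z) l" for l
    by (simp add: taylor_operator_of[OF c] taylor_cmult operator_of_entire[OF c] f entire_cmult
        suminf_mult mult.assoc)
qed (use assms in \<open>auto intro: operator_of_entire\<close>)

lemma operator_of_diff:
  assumes c: "c \<in> matrices M k" and f: "f \<in> entire" "g \<in> entire"
  shows "operator_of c (\<lambda>z. f z - g z) = (\<lambda>z. operator_of c f z - operator_of c g z)"
  using operator_of_add[OF c f(1) entire_cmult[OF f(2)], of "-1"] operator_of_cmult[OF c f(2), of "-1"]
  by simp

lemma operator_of_sum:
  assumes c: "c \<in> matrices M k" and I: "finite I" and f: "\<And>i. i \<in> I \<Longrightarrow> f i \<in> entire"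
  shows "operator_of c (\<lambda>z. \<Sum>i\<in>I. a i * f i z) = (\<lambda>z. \<Sum>i\<in>I. a i * operator_of c (f i) z)"
  using I f
proof (induction I rule: finite_induct)
  case empty
  then show ?case using operator_of_cmult[OF c, of "\<lambda>z. 0" 0] by (simp add: entire_def)
next
  case (insert x I)
  then show ?case
    by (simp add: operator_of_add[OF c] operator_of_cmult[OF c] entire_cmult entire_sum)
qed

lemma operator_of_iter_entire:
  "c \<in> matrices M k \<Longrightarrow> f \<in> entire \<Longrightarrow> (operator_of c ^^ n) f \<in> entire"
  by (induction n) (auto intro: operator_of_entire)

lemma operator_of_iter_sum:
  assumes c: "c \<in> matrices M k" and I: "finite I" and f: "\<And>i. i \<in> I \<Longrightarrow> f i \<in> entire"
  shows "(operator_of c ^^ n) (\<lambda>z. \<Sum>i\<in>I. a i * f i z) = (\<lambda>z. \<Sum>i\<in>I. a i * (operator_of c ^^ n) (f i) z)"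
proof (induction n)
  case (Suc n)
  then show ?case
    using operator_of_sum[OF c I, of "\<lambda>i. (operator_of c ^^ n) (f i)" a]
    by (simp add: operator_of_iter_entire[OF c] f)
qed simp

lemma operator_of_in_operators:
  assumes c: "c \<in> matrices M k"
  shows "operator_of c \<in> operators M k"
  unfolding operators_def
proof (intro CollectI conjI)
  show "operator_of c \<in> entire \<rightarrow>\<^sub>E entire"
    using operator_of_entire[OF c] by (auto simp: operator_of_def)
  show "linear_on_entire (operator_of c)"
    unfolding linear_on_entire_def by (simp add: operator_of_add[OF c] operator_of_cmult[OF c])
  show "\<forall>j\<ge>1. \<forall>f\<in>entire. N j (operator_of c f) \<le> M j * N (k j) f"
    using N_operator_of[OF c] by blast
  show "continuous_map entire_topology entire_topology (operator_of c)"
    unfolding continuous_map_def topspace_entire_topology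
  proof (intro conjI allI impI)
    show "operator_of c \<in> entire \<rightarrow> entire" using operator_of_entire[OF c] by auto
    fix U assume U: "openin entire_topology U"
    show "openin entire_topology {f \<in> entire. operator_of c f \<in> U}"
      unfolding openin_entire_iff
    proof (intro conjI ballI)
      fix f assume "f \<in> {f \<in> entire. operator_of c f \<in> U}"
      then have f: "f \<in> entire" "operator_of c f \<in> U" by auto
      with U obtain j e where je: "j \<ge> 1" "e > 0"
        "{g \<in> entire. N j (\<lambda>z. g z - operator_of c f z) < e} \<subseteq> U"
        unfolding openin_entire_iff by meson
      have M: "M j \<ge> 0" by (rule matrices_nonneg[OF c je(1)])
      have "operator_of c g \<in> U" if g: "g \<in> entire" "N (Suc (k j)) (\<lambda>z. g z - f z) < e / (M j + 1)" for g
      proof -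
        have "N j (\<lambda>z. operator_of c g z - operator_of c f z) \<le> M j * N (k j) (\<lambda>z. g z - f z)"
          using N_operator_of[OF c entire_diff[OF g(1) f(1)] je(1)] operator_of_diff[OF c g(1) f(1)] by simp
        also have "\<dots> \<le> (M j + 1) * N (Suc (k j)) (\<lambda>z. g z - f z)"
          using M f g by (intro mult_mono N_mono N_nonneg entire_diff) auto
        also have "\<dots> < e" using g(2) M by (simp add: field_simps)
        finally show ?thesis using je(3) operator_of_entire[OF c g(1)] by blast
      qed
      then show "\<exists>i d. i \<ge> 1 \<and> d > 0 \<and>
          {g \<in> entire. N i (\<lambda>z. g z - f z) < d} \<subseteq> {f \<in> entire. operator_of c f \<in> U}"
        using M je(2) by (intro exI[of _ "Suc (k j)"] exI[of _ "e / (M j + 1)"]) auto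
    qed auto
  qed
qed

lemma operator_of_monomial:
  assumes c: "c \<in> matrices M k"
  shows "taylor (operator_of c (\<lambda>z. z ^ q)) l = c q l"
proof -
  have "(\<lambda>i. taylor (\<lambda>z. z ^ q) i * c i l) = (\<lambda>i. if i = q then c i l else 0)"
    by (auto simp: taylor_monomial)
  then show ?thesis
    by (simp add: taylor_operator_of[OF c] sums_unique[OF sums_single, symmetric])
qed

lemma matrix_of_operator_of: "c \<in> matrices M k \<Longrightarrow> matrix_of (operator_of c) = c"
  by (simp add: fun_eq_iff matrix_of_def operator_of_monomial)

lemma matrix_of_in_matrices:
  assumes "T \<in> operators M k" shows "matrix_of T \<in> matrices M k"
proof -
  have "(\<lambda>q. taylor (T (\<lambda>z. z ^ q))) \<in> matrices M k"
  proof (rule matricesI)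
    show "T (\<lambda>z. z ^ q) \<in> entire" for q using assms by (auto simp: operators_def)
    show "N j (T (\<lambda>z. z ^ q)) \<le> M j * real (k j) ^ q" if "j \<ge> 1" for q j
    proof -
      have "N j (T (\<lambda>z. z ^ q)) \<le> M j * N (k j) (\<lambda>z. z ^ q)"
        using assms that entire_power[of q] unfolding operators_def by blast
      then show ?thesis by (simp add: N_monomial)
    qed
  qed
  then show ?thesis by (simp add: matrix_of_def[abs_def])
qed

text \<open>
  An operator is determined by its values on monomials: it agrees with its matrix on the Taylor
  polynomials of \<open>f\<close> by linearity, and the bound for \<open>j = 1\<close> passes this to the limit.
\<close>

lemma operator_of_matrix_of:
  assumes T: "T \<in> operators M k" shows "operator_of (matrix_of T) = T"
proof
  have ent: "T f \<in> entire" if "f \<in> entire" for f using T that by (auto simp: operators_def)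
  have lin_add: "T (\<lambda>z. f z + g z) = (\<lambda>z. T f z + T g z)" if "f \<in> entire" "g \<in> entire" for f g
    using T that by (auto simp: operators_def linear_on_entire_def)
  have lin_mult: "T (\<lambda>z. a * f z) = (\<lambda>z. a * T f z)" if "f \<in> entire" for f a
    using T that by (auto simp: operators_def linear_on_entire_def)
  have bound: "N j (T f) \<le> M j * N (k j) f" if "f \<in> entire" "j \<ge> 1" for f j
    using T that by (auto simp: operators_def)
  note c = matrix_of_in_matrices[OF T]
  fix f
  show "operator_of (matrix_of T) f = T f"
  proof (cases "f \<in> entire")
    case False
    then show ?thesis using T by (auto simp: operators_def operator_of_def)
  next
    case f: True
    define p where "p Q = poly (\<Sum>q<Q. monom (taylor f q) q)" for Q
    have p: "p Q \<in> entire" for Q by (simp add: p_def)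
    have p_Suc: "p (Suc Q) = (\<lambda>z. p Q z + taylor f Q * z ^ Q)" for Q
      by (simp add: p_def poly_monom fun_eq_iff)
    have p0: "p 0 = (\<lambda>z. 0 * z ^ 0)" by (simp add: p_def fun_eq_iff)
    have Tp: "taylor (T (p Q)) l = (\<Sum>q<Q. taylor f q * matrix_of T q l)" for Q l
    proof (induction Q)
      case 0
      then show ?case by (subst p0, subst lin_mult) (auto simp: taylor_cmult ent)
    next
      case (Suc Q)
      then show ?case
        by (simp add: p_Suc lin_add[OF p] lin_mult entire_cmult taylor_add ent p taylor_cmult matrix_of_def)
    qed
    have lim0: "(\<lambda>Q. N (Suc (k 1)) (\<lambda>z. f z - p Q z)) \<longlonglongrightarrow> 0"
      unfolding p_def by (rule taylor_polynomial_tendsto[OF f]) simp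
    have M: "M 1 \<ge> 0" by (rule matrices_nonneg[OF c]) simp
    have "taylor (T f) l = (\<Sum>q. taylor f q * matrix_of T q l)" for l
    proof -
      have "(\<lambda>Q. taylor (T (p Q)) l) \<longlonglongrightarrow> taylor (T f) l"
      proof (rule Lim_transform_bound[THEN LIM_zero_cancel])
        show "\<forall>\<^sub>F Q in sequentially. norm (taylor (T (p Q)) l - taylor (T f) l)
            \<le> norm (M 1 * N (Suc (k 1)) (\<lambda>z. f z - p Q z))"
        proof (intro always_eventually allI)
          fix Q
          have d: "(\<lambda>z. f z - p Q z) \<in> entire" using f p by auto
          have "T f = (\<lambda>z. T (\<lambda>z. f z - p Q z) z + T (p Q) z)"
            using lin_add[OF d p, of Q] by simp
          then have "taylor (T f) l = taylor (T (\<lambda>z. f z - p Q z)) l + taylor (T (p Q)) l"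
            using taylor_add[OF ent[OF d] ent[OF p]] by metis
          then have "norm (taylor (T (p Q)) l - taylor (T f) l) \<le> N 1 (T (\<lambda>z. f z - p Q z))"
            using taylor_le_N[OF ent[OF d], of 1 l] by simp
          also have "\<dots> \<le> M 1 * N (k 1) (\<lambda>z. f z - p Q z)" using bound[OF d] by simp
          also have "\<dots> \<le> M 1 * N (Suc (k 1)) (\<lambda>z. f z - p Q z)"
            using M d by (intro mult_left_mono N_mono) auto
          finally show "norm (taylor (T (p Q)) l - taylor (T f) l)
            \<le> norm (M 1 * N (Suc (k 1)) (\<lambda>z. f z - p Q z))" by simp
        qed
        show "(\<lambda>Q. M 1 * N (Suc (k 1)) (\<lambda>z. f z - p Q z)) \<longlonglongrightarrow> 0"
          using tendsto_mult_right_zero[OF lim0] by simp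
      qed
      then have "(\<lambda>q. taylor f q * matrix_of T q l) sums taylor (T f) l"
        unfolding Tp sums_def .
      then show ?thesis by (simp add: sums_iff)
    qed
    then show ?thesis
      by (intro taylor_unique operator_of_entire[OF c f] ent f) (simp add: taylor_operator_of[OF c f])
  qed
qed

section \<open>Matrices and the strong operator topology\<close>

text \<open>Tannery's theorem gives the convergence of each coefficient, and the common bounds on the
  matrices turn this into convergence for the seminorms.\<close>

lemma operator_of_tendsto:
  assumes c: "\<And>s. c s \<in> matrices M k" "c' \<in> matrices M k"
    and lim: "\<And>q l. (\<lambda>s. c s q l) \<longlonglongrightarrow> c' q l"
    and f: "f \<in> entire" and j: "j \<ge> 1"
  shows "(\<lambda>s. N j (\<lambda>z. operator_of (c s) f z - operator_of c' f z)) \<longlonglongrightarrow> 0"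
proof (rule N_tendsto_0[OF _ _ _ j])
  note [simp] = operator_of_entire[OF c(1) f] operator_of_entire[OF c(2) f]
  show "(\<lambda>z. operator_of (c s) f z - operator_of c' f z) \<in> entire" for s by auto
  show "N j (\<lambda>z. operator_of (c s) f z - operator_of c' f z) \<le> 2 * (M j * N (k j) f)" if "j \<ge> 1" for s j
    using N_diff[of "operator_of (c s) f" "operator_of c' f" j] N_operator_of[OF c(1) f that, of s]
      N_operator_of[OF c(2) f that] by simp
  fix l
  have "(\<lambda>s. \<Sum>q. taylor f q * c s q l) \<longlonglongrightarrow> (\<Sum>q. taylor f q * c' q l)"
  proof (rule conjunct2[OF conjunct2[OF tannerys_theorem]])
    show "(\<lambda>s. taylor f q * c s q l) \<longlonglongrightarrow> taylor f q * c' q l" for q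
      by (intro tendsto_intros lim)
    show "\<forall>\<^sub>F (q, s) in sequentially \<times>\<^sub>F sequentially.
        norm (taylor f q * c s q l) \<le> M 1 * (norm (taylor f q) * real (k 1) ^ q)"
    proof (intro always_eventually allI, clarify)
      fix q s
      show "norm (taylor f q * c s q l) \<le> M 1 * (norm (taylor f q) * real (k 1) ^ q)"
        using mult_left_mono[OF matrices_entry_bound[OF c(1), of 1 s q l], of "norm (taylor f q)"]
        by (simp add: mult_ac norm_mult)
    qed
    show "summable (\<lambda>q. M 1 * (norm (taylor f q) * real (k 1) ^ q))"
      by (intro summable_mult summable_taylor f)
  qed simp
  then show "(\<lambda>s. taylor (\<lambda>z. operator_of (c s) f z - operator_of c' f z) l) \<longlonglongrightarrow> 0"
    by (simp add: taylor_diff taylor_operator_of[OF c(1) f] taylor_operator_of[OF c(2) f] LIM_zero)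
qed

text \<open>
  Composition is not jointly continuous for the strong operator topology in general; it is here
  because the operators obey common bounds, as the splitting
  \<open>T\<^sub>s x\<^sub>s - T y = T\<^sub>s (x\<^sub>s - y) + (T\<^sub>s y - T y)\<close> shows.
\<close>

lemma operator_of_iter_tendsto:
  assumes c: "\<And>s. c s \<in> matrices M k" "c' \<in> matrices M k"
    and lim: "\<And>q l. (\<lambda>s. c s q l) \<longlonglongrightarrow> c' q l"
    and f: "f \<in> entire" and j: "j \<ge> 1"
  shows "(\<lambda>s. N j (\<lambda>z. (operator_of (c s) ^^ n) f z - (operator_of c' ^^ n) f z)) \<longlonglongrightarrow> 0"
  using j
proof (induction n arbitrary: j)
  case 0
  then show ?case by simp
next
  case (Suc n)
  define x where "x s = (operator_of (c s) ^^ n) f" for s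
  define y where "y = (operator_of c' ^^ n) f"
  have x: "x s \<in> entire" for s unfolding x_def by (intro operator_of_iter_entire[OF c(1)] f)
  have y: "y \<in> entire" unfolding y_def by (intro operator_of_iter_entire[OF c(2)] f)
  have M: "M j \<ge> 0" by (rule matrices_nonneg[OF c(2) Suc.prems])
  have lim: "(\<lambda>s. M j * N (Suc (k j)) (\<lambda>z. x s z - y z) +
      N j (\<lambda>z. operator_of (c s) y z - operator_of c' y z)) \<longlonglongrightarrow> M j * 0 + 0"
    unfolding x_def y_def
    by (intro tendsto_intros Suc.IH operator_of_tendsto[OF c assms(3) _ Suc.prems]
        operator_of_iter_entire[OF c(2)] f) simp
  have le: "N j (\<lambda>z. operator_of (c s) (x s) z - operator_of c' y z)
      \<le> M j * N (Suc (k j)) (\<lambda>z. x s z - y z) + N j (\<lambda>z. operator_of (c s) y z - operator_of c' y z)" for s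
  proof -
    have "N j (\<lambda>z. operator_of (c s) (x s) z - operator_of c' y z)
        \<le> N j (\<lambda>z. operator_of (c s) (x s) z - operator_of (c s) y z)
          + N j (\<lambda>z. operator_of (c s) y z - operator_of c' y z)"
      by (intro N_diff_triangle operator_of_entire[OF c(1)] operator_of_entire[OF c(2)] x y)
    also have "N j (\<lambda>z. operator_of (c s) (x s) z - operator_of (c s) y z)
        \<le> M j * N (k j) (\<lambda>z. x s z - y z)"
      using N_operator_of[OF c(1) entire_diff[OF x y] Suc.prems, of s s] operator_of_diff[OF c(1) x y, of s s]
      by simp
    also have "\<dots> \<le> M j * N (Suc (k j)) (\<lambda>z. x s z - y z)"
      using M x y by (intro mult_left_mono N_mono) auto
    finally show ?thesis by simp
  qed
  have "(\<lambda>s. N j (\<lambda>z. operator_of (c s) (x s) z - operator_of c' y z)) \<longlonglongrightarrow> 0"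
  proof (rule Lim_null_comparison)
    have "0 \<le> N j (\<lambda>z. operator_of (c s) (x s) z - operator_of c' y z)" for s
      by (intro N_nonneg entire_diff operator_of_entire[OF c(1)] operator_of_entire[OF c(2)] x y)
    then show "\<forall>\<^sub>F s in sequentially. norm (N j (\<lambda>z. operator_of (c s) (x s) z - operator_of c' y z))
        \<le> M j * N (Suc (k j)) (\<lambda>z. x s z - y z) + N j (\<lambda>z. operator_of (c s) y z - operator_of c' y z)"
      using le by (intro always_eventually allI) simp
  qed (use lim in simp)
  then show ?case by (simp add: x_def y_def)
qed

lemma continuous_on_entry:
  "continuous_on UNIV (\<lambda>c :: nat \<Rightarrow> nat \<Rightarrow> complex. c q l)"
  by (rule continuous_on_compose2[OF continuous_on_product_coordinates continuous_on_product_coordinates]) auto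

lemma closed_matrices: "closed (matrices M k)"
proof -
  have "matrices M k = (\<Inter>q. \<Inter>j\<in>{1..}. \<Inter>L. {c. (\<Sum>l<L. norm (c q l) * real j ^ l) \<le> M j * real (k j) ^ q})"
    by (auto simp: matrices_def)
  moreover have "closed {c :: nat \<Rightarrow> nat \<Rightarrow> complex. (\<Sum>l<L. norm (c q l) * real j ^ l) \<le> M j * real (k j) ^ q}" for q j L
    by (rule closed_Collect_le)
       (rule continuous_on_sum continuous_on_mult continuous_on_norm continuous_on_entry continuous_on_const)+
  ultimately show ?thesis by (auto intro!: closed_INT)
qed

lemma fun_tendsto_coordinate:
  fixes c :: "nat \<Rightarrow> nat \<Rightarrow> nat \<Rightarrow> complex"
  assumes "c \<longlonglongrightarrow> c'" shows "(\<lambda>s. c s q l) \<longlonglongrightarrow> c' q l"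
  using continuous_on_tendsto_compose[OF continuous_on_entry assms] by simp

text \<open>The space of matrices is metrizable, so continuity can be tested on sequences.\<close>

lemma openin_matrices_vimage:
  fixes F :: "(nat \<Rightarrow> nat \<Rightarrow> complex) \<Rightarrow> complex \<Rightarrow> complex"
  assumes ent: "\<And>c. c \<in> matrices M k \<Longrightarrow> F c \<in> entire"
    and lim: "\<And>c c' j. (\<And>s. c s \<in> matrices M k) \<Longrightarrow> c' \<in> matrices M k \<Longrightarrow>
        (\<And>q l. (\<lambda>s. c s q l) \<longlonglongrightarrow> c' q l) \<Longrightarrow> j \<ge> 1 \<Longrightarrow>
        (\<lambda>s. N j (\<lambda>z. F (c s) z - F c' z)) \<longlonglongrightarrow> 0"
    and U: "openin entire_topology U"
  shows "openin (top_of_set (matrices M k)) {c \<in> matrices M k. F c \<in> U}"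
  unfolding openin_euclidean_subtopology_iff
proof (intro conjI ballI)
  fix c' assume "c' \<in> {c \<in> matrices M k. F c \<in> U}"
  then have c': "c' \<in> matrices M k" "F c' \<in> U" by auto
  with U obtain j e where je: "j \<ge> 1" "e > 0" "{g \<in> entire. N j (\<lambda>z. g z - F c' z) < e} \<subseteq> U"
    unfolding openin_entire_iff by meson
  show "\<exists>e>0. \<forall>x'\<in>matrices M k. dist x' c' < e \<longrightarrow> x' \<in> {c \<in> matrices M k. F c \<in> U}"
  proof (rule ccontr)
    assume neg: "\<not> ?thesis"
    have "\<exists>x\<in>matrices M k. dist x c' < 1 / real (Suc s) \<and> F x \<notin> U" for s
      using neg by (force dest: spec[of _ "1 / real (Suc s)"])
    then obtain c where c: "\<And>s. c s \<in> matrices M k" "\<And>s. dist (c s) c' < 1 / real (Suc s)"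
      "\<And>s. F (c s) \<notin> U" by metis
    have "(\<lambda>s. dist (c s) c') \<longlonglongrightarrow> 0"
      by (rule tendsto_sandwich[OF _ _ tendsto_const LIMSEQ_inverse_real_of_nat])
         (use c(2) in \<open>auto intro!: always_eventually less_imp_le simp: inverse_eq_divide\<close>)
    then have "c \<longlonglongrightarrow> c'" by (rule tendsto_dist_iff[THEN iffD2])
    then have "(\<lambda>s. N j (\<lambda>z. F (c s) z - F c' z)) \<longlonglongrightarrow> 0"
      by (intro lim[OF c(1) c'(1) _ je(1)] fun_tendsto_coordinate)
    then have "\<forall>\<^sub>F s in sequentially. N j (\<lambda>z. F (c s) z - F c' z) < e"
      using je(2) by (rule order_tendstoD)
    then obtain s where "N j (\<lambda>z. F (c s) z - F c' z) < e"
      using eventually_happens'[OF sequentially_bot] by blast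
    then show False using je(3) c(1,3) ent by blast
  qed
qed auto

lemma continuous_map_operator_of:
  "continuous_map (top_of_set (matrices M k)) (operator_space M k) operator_of"
  unfolding operator_space_def continuous_map_in_subtopology SOT_def continuous_map_componentwise
proof (intro conjI ballI)
  show "operator_of ` topspace (top_of_set (matrices M k)) \<subseteq> extensional entire"
    by (auto simp: operator_of_def)
  show "operator_of \<in> topspace (top_of_set (matrices M k)) \<rightarrow> operators M k"
    by (auto intro: operator_of_in_operators)
  fix f assume f: "f \<in> entire"
  show "continuous_map (top_of_set (matrices M k)) entire_topology (\<lambda>c. operator_of c f)"
    unfolding continuous_map_def topspace_entire_topology topspace_euclidean_subtopology
  proof (intro conjI allI impI)
    show "(\<lambda>c. operator_of c f) \<in> matrices M k \<rightarrow> entire"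
      by (auto intro: operator_of_entire[OF _ f])
    show "openin (top_of_set (matrices M k)) {c \<in> matrices M k. operator_of c f \<in> U}"
      if "openin entire_topology U" for U
      by (rule openin_matrices_vimage[OF _ _ that])
         (rule operator_of_entire[OF _ f] operator_of_tendsto[OF _ _ _ f] | assumption)+
  qed
qed

lemma continuous_map_taylor: "continuous_map entire_topology euclidean (\<lambda>f. taylor f l)"
  unfolding continuous_map_def
proof (intro conjI allI impI)
  fix U :: "complex set" assume "openin euclidean U"
  then have U: "open U" by simp
  show "openin entire_topology {f \<in> topspace entire_topology. taylor f l \<in> U}"
    unfolding openin_entire_iff
  proof (intro conjI ballI)
    fix f assume "f \<in> {f \<in> topspace entire_topology. taylor f l \<in> U}"
    then have f: "f \<in> entire" "taylor f l \<in> U" by auto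
    then obtain e where e: "e > 0" "\<And>w. dist w (taylor f l) < e \<Longrightarrow> w \<in> U"
      using U unfolding open_dist by blast
    have "taylor g l \<in> U" if g: "g \<in> entire" "N 1 (\<lambda>z. g z - f z) < e" for g
      using taylor_le_N[OF entire_diff[OF g(1) f(1)], of 1 l] g f
      by (intro e) (simp add: dist_norm taylor_diff)
    then show "\<exists>j e. j \<ge> 1 \<and> e > 0 \<and>
        {g \<in> entire. N j (\<lambda>z. g z - f z) < e} \<subseteq> {f \<in> topspace entire_topology. taylor f l \<in> U}"
      using e(1) by (intro exI[of _ 1] exI[of _ e]) auto
  qed auto
qed auto

lemma continuous_map_matrix_of:
  "continuous_map (operator_space M k) (top_of_set (matrices M k)) matrix_of"
  unfolding continuous_map_in_subtopology
proof
  show "matrix_of \<in> topspace (operator_space M k) \<rightarrow> matrices M k"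
    by (auto intro: matrix_of_in_matrices)
  have "continuous_map (operator_space M k) euclidean (\<lambda>T. matrix_of T q l)" for q l
  proof -
    have "continuous_map (operator_space M k) entire_topology (\<lambda>T. T (\<lambda>z. z ^ q))"
      unfolding operator_space_def SOT_def
      by (intro continuous_map_from_subtopology continuous_map_product_projection) simp
    from continuous_map_compose[OF this continuous_map_taylor[of l]] show ?thesis
      by (simp add: o_def matrix_of_def)
  qed
  then show "continuous_map (operator_space M k) euclidean matrix_of"
    by (simp add: euclidean_product_topology[symmetric] continuous_map_componentwise_UNIV)
qed

section \<open>Polynomials\<close>

lemma N_poly:
  assumes "degree p \<le> D"
  shows "N j (poly p) = (\<Sum>l\<le>D. norm (coeff p l) * real j ^ l)"
  unfolding N_eq taylor_poly
  by (rule suminf_finite) (use assms in \<open>auto simp: coeff_eq_0\<close>)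

lemma N_poly_smult: "N j (poly (smult a p)) = norm a * N j (poly p)"
  using N_cmult[of "poly p" j a] by (simp add: poly_smult[abs_def])

lemma N_poly_add: "N j (poly (p + q)) \<le> N j (poly p) + N j (poly q)"
  using N_add[of "poly p" "poly q" j] by (simp add: poly_add[abs_def])

lemma N_poly_diff: "N j (poly (p - q)) \<le> N j (poly p) + N j (poly q)"
  using N_diff[of "poly p" "poly q" j] by (simp add: poly_diff[abs_def])

lemma N_poly_monom: "N j (poly (monom a n)) = norm a * real j ^ n"
  by (subst N_poly[of _ n]) (simp_all add: degree_monom_le if_distrib[of "\<lambda>x. norm x * _"] cong: if_cong)

lemma N_poly_sum:
  "finite I \<Longrightarrow> N j (poly (\<Sum>i\<in>I. p i)) \<le> (\<Sum>i\<in>I. N j (poly (p i)))"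
  using N_sum[of I "\<lambda>i. poly (p i)" j] by (simp add: poly_sum[abs_def])

lemma N_poly_shift: "N j (poly (monom 1 a * p)) \<le> real j ^ a * N j (poly p)"
proof -
  have "monom 1 a * p = (\<Sum>l\<le>degree p. monom (coeff p l) (a + l))"
    by (subst (1) poly_as_sum_of_monoms[of p, symmetric]) (simp add: sum_distrib_left mult_monom)
  then have "N j (poly (monom 1 a * p)) \<le> (\<Sum>l\<le>degree p. N j (poly (monom (coeff p l) (a + l))))"
    by (simp add: N_poly_sum)
  also have "\<dots> = real j ^ a * N j (poly p)"
    by (simp add: N_poly_monom N_poly[of p "degree p"] sum_distrib_left power_add mult_ac)
  finally show ?thesis .
qed

text \<open>On polynomials of bounded degree the growth in \<open>j\<close> is explicit, and only \<open>N\<^sub>1\<close> remains to be controlled.\<close>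

lemma N_poly_degree:
  assumes "degree p \<le> D" "j \<ge> 1" "N 1 (poly p) \<le> B"
  shows "N j (poly p) \<le> real j ^ D * B"
proof -
  have "N j (poly p) \<le> real j ^ D * N 1 (poly p)"
    using assms(2)
    by (auto simp: N_poly[OF assms(1)] sum_distrib_left mult.commute[of "real j ^ D"]
        intro!: sum_mono mult_left_mono power_increasing)
  also have "\<dots> \<le> real j ^ D * B" using assms(3) by (intro mult_left_mono) auto
  finally show ?thesis .
qed

text \<open>The operator whose rows are polynomials, seen on polynomials, where no convergence is involved.\<close>

definition apply_rows :: "(nat \<Rightarrow> complex poly) \<Rightarrow> complex poly \<Rightarrow> complex poly" where
  "apply_rows G p = (\<Sum>q\<le>degree p. smult (coeff p q) (G q))"

lemma apply_rows_cutoff: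
  assumes "degree p \<le> Q"
  shows "apply_rows G p = (\<Sum>q\<le>Q. smult (coeff p q) (G q))"
  unfolding apply_rows_def using assms
  by (intro sum.mono_neutral_left) (auto simp: coeff_eq_0)

lemma apply_rows_add: "apply_rows G (p + q) = apply_rows G p + apply_rows G q"
  using apply_rows_cutoff[of _ "max (degree p) (degree q)" G]
  by (simp add: degree_add_le smult_add_left sum.distrib)

lemma apply_rows_monom: "apply_rows G (monom a n) = smult a (G n)"
proof -
  have "apply_rows G (monom a n) = (\<Sum>q\<le>n. if q = n then smult a (G q) else 0)"
    unfolding apply_rows_cutoff[OF degree_monom_le] by (intro sum.cong refl) auto
  then show ?thesis by simp
qed

lemma degree_apply_rows:
  assumes "\<And>n. n \<le> D \<Longrightarrow> degree (G n) \<le> D" "degree p \<le> D"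
  shows "degree (apply_rows G p) \<le> D"
  unfolding apply_rows_cutoff[OF assms(2)]
  by (intro degree_sum_le) (auto intro: order_trans[OF degree_smult_le] assms)

lemma N_apply_rows:
  assumes "\<And>n. n \<le> D \<Longrightarrow> N 1 (poly (G n)) \<le> K" "degree p \<le> D"
  shows "N 1 (poly (apply_rows G p)) \<le> K * N 1 (poly p)"
proof -
  have "N 1 (poly (apply_rows G p)) \<le> (\<Sum>n\<le>D. norm (coeff p n) * N 1 (poly (G n)))"
    unfolding apply_rows_cutoff[OF assms(2)]
    by (rule order_trans[OF N_poly_sum]) (auto simp: N_poly_smult)
  also have "\<dots> \<le> (\<Sum>n\<le>D. norm (coeff p n) * K)"
    by (intro sum_mono mult_left_mono assms) auto
  also have "\<dots> = K * N 1 (poly p)"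
    by (simp add: N_poly[OF assms(2)] sum_distrib_left mult_ac)
  finally show ?thesis .
qed

lemma operator_of_poly:
  assumes c: "(\<lambda>q. coeff (G q)) \<in> matrices M k"
  shows "operator_of (\<lambda>q. coeff (G q)) (poly p) = poly (apply_rows G p)"
proof -
  have row: "operator_of (\<lambda>q. coeff (G q)) (\<lambda>z. z ^ q) = poly (G q)" for q
    by (rule taylor_unique) (auto intro: operator_of_entire[OF c] simp: operator_of_monomial[OF c] taylor_poly)
  have "poly p = (\<lambda>z. \<Sum>q\<le>degree p. coeff p q * z ^ q)"
    by (simp add: fun_eq_iff poly_altdef)
  then have "operator_of (\<lambda>q. coeff (G q)) (poly p)
      = (\<lambda>z. \<Sum>q\<le>degree p. coeff p q * poly (G q) z)"
    using operator_of_sum[OF c, of "{..degree p}" "\<lambda>q z. z ^ q" "coeff p"] by (simp add: row)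
  then show ?thesis by (simp add: apply_rows_def poly_sum fun_eq_iff)
qed

lemma operator_of_iter_poly:
  assumes c: "(\<lambda>q. coeff (G q)) \<in> matrices M k"
  shows "(operator_of (\<lambda>q. coeff (G q)) ^^ n) (poly p) = poly ((apply_rows G ^^ n) p)"
  by (induction n) (simp_all add: operator_of_poly[OF c])

text \<open>The coefficients of Taylor polynomials can be moved into a countable dense set of scalars.\<close>

lemma countable_dense_polynomials:
  "\<exists>Q :: complex poly set. countable Q \<and>
    (\<forall>f\<in>entire. \<forall>j\<ge>1. \<forall>e>0. \<exists>p\<in>Q. N j (\<lambda>z. poly p z - f z) < e)"
proof -
  obtain D :: "complex set" where D: "countable D" "\<And>X. open X \<Longrightarrow> X \<noteq> {} \<Longrightarrow> \<exists>d\<in>D. d \<in> X"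
    using countable_dense_exists by blast
  define Q where "Q = {p. set (coeffs p) \<subseteq> insert 0 D}"
  have "countable (coeffs ` Q)"
    by (rule countable_subset[OF _ countable_lists[of "insert 0 D"]]) (use D(1) in \<open>auto simp: Q_def lists_eq_set\<close>)
  then have "countable Q"
    by (rule countable_image_inj_on) (auto simp: inj_on_def coeffs_eq_iff)
  moreover have "\<exists>p\<in>Q. N j (\<lambda>z. poly p z - f z) < e" if f: "f \<in> entire" and j: "j \<ge> 1" and e: "e > 0" for f j e
  proof -
    have "\<forall>\<^sub>F L in sequentially. N j (\<lambda>z. f z - poly (\<Sum>q<L. monom (taylor f q) q) z) < e / 2"
      using taylor_polynomial_tendsto[OF f j] e by (intro order_tendstoD) auto
    then obtain L where L: "N j (\<lambda>z. f z - poly (\<Sum>q<L. monom (taylor f q) q) z) < e / 2"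
      using eventually_happens'[OF sequentially_bot] by blast
    define r where "r = e / (2 * real (Suc L) * real j ^ L)"
    have r: "r > 0" using e j by (simp add: r_def)
    have "\<exists>d\<in>D. d \<in> ball (taylor f q) r" for q using r by (intro D(2)) auto
    then obtain d where d: "\<And>q. d q \<in> D" "\<And>q. norm (taylor f q - d q) < r"
      by (metis mem_ball dist_norm)
    define p where "p = (\<Sum>q<L. monom (d q) q)"
    have cp: "coeff p l = (if l < L then d l else 0)" for l by (simp add: p_def coeff_sum)
    have "p \<in> Q" unfolding Q_def coeffs_def using d(1) by (auto simp: cp)
    have "N j (\<lambda>z. f z - poly p z) \<le> N j (\<lambda>z. f z - poly (\<Sum>q<L. monom (taylor f q) q) z)
        + N j (\<lambda>z. poly (\<Sum>q<L. monom (taylor f q) q) z - poly p z)"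
      using f by (intro N_diff_triangle) auto
    also have "(\<lambda>z. poly (\<Sum>q<L. monom (taylor f q) q) z - poly p z)
        = (\<lambda>z. \<Sum>q<L. (taylor f q - d q) * z ^ q)"
      by (simp add: p_def poly_sum poly_monom sum_subtractf algebra_simps)
    also have "N j (\<lambda>z. \<Sum>q<L. (taylor f q - d q) * z ^ q) \<le> (\<Sum>q<L. norm (taylor f q - d q) * real j ^ q)"
      by (rule order_trans[OF N_sum]) (auto simp: N_cmult N_monomial)
    also have "\<dots> \<le> (\<Sum>q<L. r * real j ^ L)"
      using d(2) j r by (intro sum_mono mult_mono power_increasing) (auto intro: less_imp_le)
    also have "\<dots> = real L * (e / (2 * real (Suc L)))" using j by (simp add: r_def)
    also have "\<dots> < e / 2" using e by (simp add: field_simps)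
    finally have "N j (\<lambda>z. f z - poly p z) < e" using L by simp
    moreover have "N j (\<lambda>z. poly p z - f z) = N j (\<lambda>z. f z - poly p z)"
      using N_cmult[of "\<lambda>z. f z - poly p z" j "-1"] f by (simp add: entire_diff)
    ultimately have "N j (\<lambda>z. poly p z - f z) < e" by linarith
    with \<open>p \<in> Q\<close> show ?thesis by (rule bexI[rotated])
  qed
  ultimately show ?thesis by blast
qed

section \<open>Reaching prescribed targets after a small perturbation\<close>

locale fast_weights =
  fixes M :: "nat \<Rightarrow> real" and k :: "nat \<Rightarrow> nat"
  assumes M_growth: "\<And>\<alpha>::real. \<alpha> \<ge> 1 \<Longrightarrow> (\<lambda>j. real j powr \<alpha>) \<in> o(M)"
    and M_ge_1: "\<And>j. j \<ge> 1 \<Longrightarrow> M j \<ge> 1"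
    and k_ge: "\<And>j. j \<ge> 1 \<Longrightarrow> k j \<ge> j + 2"
begin

lemma power_le_M:
  assumes "C > 0"
  shows "\<exists>J\<ge>1. \<forall>j\<ge>J. C * real j ^ p \<le> M j"
proof -
  have "\<forall>\<^sub>F j in sequentially. norm (real j powr real (Suc p)) \<le> (1 / C) * norm (M j)"
    using M_growth[of "real (Suc p)"] assms by (intro landau_o.smallD) auto
  then obtain J where J: "\<And>j. j \<ge> J \<Longrightarrow> real j powr real (Suc p) \<le> (1 / C) * \<bar>M j\<bar>"
    unfolding eventually_sequentially by auto
  have "C * real j ^ p \<le> M j" if "j \<ge> max J 1" for j
  proof -
    have "C * real j ^ p \<le> C * real j ^ Suc p"
      using that assms by (intro mult_left_mono power_increasing) auto
    also have "\<dots> \<le> M j"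
      using J[of j] that assms M_ge_1[of j] by (simp add: powr_realpow[symmetric] field_simps del: power_Suc)
    finally show ?thesis .
  qed
  then show ?thesis by (intro exI[of _ "max J 1"]) auto
qed

lemma power_le_M_const:
  "\<exists>\<delta>>0. \<forall>j\<ge>1. \<delta> * real j ^ p \<le> M j"
proof -
  obtain J where J: "J \<ge> 1" "\<And>j. j \<ge> J \<Longrightarrow> 1 * real j ^ p \<le> M j"
    using power_le_M[of 1 p] by auto
  have "1 / real J ^ p * real j ^ p \<le> M j" if "j \<ge> 1" for j
  proof (cases "j \<ge> J")
    case True
    have "1 / real J ^ p * real j ^ p \<le> 1 * real j ^ p"
      using J(1) by (intro mult_right_mono) auto
    then show ?thesis using J(2)[OF True] by simp
  next
    case False
    then have "1 / real J ^ p * real j ^ p \<le> 1"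
      using J(1) by (simp add: power_mono)
    then show ?thesis using M_ge_1[OF that] by simp
  qed
  then show ?thesis using J(1) by (intro exI[of _ "1 / real J ^ p"]) auto
qed

text \<open>
  For \<open>j\<close> beyond some \<open>J\<close> the growth of \<open>M\<close> suffices. For the finitely many smaller \<open>j\<close> the base
  \<open>1 + 2 / j\<close> is at least \<open>1 + 2 / J\<close>, so that a large exponent does it. The base is a lower bound
  for \<open>k\<^sub>j / j\<close>.
\<close>

lemma power_le_M_factor:
  assumes "C > 0"
  shows "\<exists>a0. \<forall>a\<ge>a0. \<forall>j\<ge>1. C * real j ^ p \<le> M j * (1 + 2 / real j) ^ a"
proof -
  obtain J where J: "J \<ge> 1" "\<And>j. j \<ge> J \<Longrightarrow> C * real j ^ p \<le> M j"
    using power_le_M[OF assms, of p] by auto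
  obtain a0 where a0: "C * real J ^ p < (1 + 2 / real J) ^ a0"
    using real_arch_pow[of "1 + 2 / real J" "C * real J ^ p"] J(1) by auto
  have "C * real j ^ p \<le> M j * (1 + 2 / real j) ^ a" if "a \<ge> a0" "j \<ge> 1" for a j
  proof (cases "j \<ge> J")
    case True
    have "C * real j ^ p \<le> M j * 1" using J(2)[OF True] by simp
    also have "\<dots> \<le> M j * (1 + 2 / real j) ^ a"
      using M_ge_1[OF that(2)] by (intro mult_left_mono one_le_power) auto
    finally show ?thesis .
  next
    case False
    have "C * real j ^ p \<le> C * real J ^ p"
      using False assms by (intro mult_left_mono power_mono) auto
    also have "\<dots> \<le> (1 + 2 / real J) ^ a0" using a0 by simp
    also have "\<dots> \<le> (1 + 2 / real J) ^ a" using that by (intro power_increasing) auto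
    also have "\<dots> \<le> (1 + 2 / real j) ^ a"
      using False that by (intro power_mono add_left_mono divide_left_mono) auto
    also have "\<dots> \<le> M j * (1 + 2 / real j) ^ a"
      using mult_right_mono[OF M_ge_1[OF that(2)], of "(1 + 2 / real j) ^ a"] by simp
    finally show ?thesis .
  qed
  then show ?thesis by blast
qed

text \<open>
  The perturbation described at the beginning. The slack \<open>\<epsilon>\<close> in the bounds for \<open>A\<close> leaves room for
  \<open>\<delta> z\<^sup>a p\<close>. The constants depend on each other in the order \<open>K, d, a, \<delta>, R\<close>: the jump \<open>d\<close> is chosen for the
  bound \<open>K\<close> on the norm of \<open>A\<close>, the starting degree \<open>a\<close> makes jumps of length \<open>d\<close> and corrections of size \<open>K\<close>
  affordable, \<open>\<delta>\<close> has to be small for this \<open>a\<close>, and the number \<open>R\<close> of jumps makes up for \<open>1 / \<delta>\<close>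
  and for the size of the targets.
\<close>

lemma ex_matrix_steering_monomials:
  fixes A \<tau> :: "nat \<Rightarrow> complex poly"
  assumes eps: "\<epsilon> > 0"
    and A_deg: "\<And>n. n \<le> D \<Longrightarrow> degree (A n) \<le> D"
    and A_bound: "\<And>n j. n \<le> D \<Longrightarrow> j \<ge> 1 \<Longrightarrow> N j (poly (A n)) \<le> (1 - \<epsilon>) * (M j * real (k j) ^ n)"
    and \<tau>_deg: "\<And>n. n \<le> D \<Longrightarrow> degree (\<tau> n) \<le> D"
  shows "\<exists>G T. (\<lambda>q. coeff (G q)) \<in> matrices M k \<and>
    (\<forall>n\<le>D. \<forall>l\<le>D. coeff (G n) l = coeff (A n) l) \<and>
    (\<forall>n\<le>D. (apply_rows G ^^ T) (monom 1 n) = \<tau> n)"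
proof -
  define K where "K = M 1 * real (k 1) ^ D"
  have K1: "K \<ge> 1"
  proof -
    have "1 * 1 \<le> M 1 * real (k 1) ^ D"
      using M_ge_1[of 1] k_ge[of 1] by (intro mult_mono one_le_power) auto
    then show ?thesis by (simp add: K_def)
  qed
  have A_K: "N 1 (poly (A n)) \<le> K" if "n \<le> D" for n
  proof -
    have "N 1 (poly (A n)) \<le> (1 - \<epsilon>) * (M 1 * real (k 1) ^ n)" using A_bound[OF that, of 1] by simp
    also have "\<dots> \<le> 1 * (M 1 * real (k 1) ^ n)"
      using eps M_ge_1[of 1] by (intro mult_right_mono) auto
    also have "\<dots> \<le> K"
      unfolding K_def using M_ge_1[of 1] k_ge[of 1] that by (auto intro!: mult_left_mono power_increasing)
    finally show ?thesis .
  qed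
  define P where "P n i = (apply_rows A ^^ i) (monom 1 n)" for n i
  have P_deg: "degree (P n i) \<le> D" if "n \<le> D" for n i
    unfolding P_def
    by (induction i) (use that in \<open>auto intro!: degree_apply_rows A_deg order_trans[OF degree_monom_le]\<close>)
  have P_K: "N 1 (poly (P n i)) \<le> K ^ i" if n: "n \<le> D" for n i
  proof (induction i)
    case 0
    then show ?case by (simp add: P_def N_poly_monom)
  next
    case (Suc i)
    have "N 1 (poly (P n (Suc i))) \<le> K * N 1 (poly (P n i))"
      using N_apply_rows[OF A_K P_deg[OF n]] by (simp add: P_def)
    also have "\<dots> \<le> K * K ^ i" using Suc K1 by (intro mult_left_mono) auto
    finally show ?case by simp
  qed

  \<comment> \<open>Besides \<open>3\<^sup>d \<ge> 2 K\<close>, \<open>d > D\<close> is needed: the blocks of degrees \<open>a + i d, \<dots>, a + i d + D\<close> must be disjoint.\<close>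
  obtain d0 where d0: "2 * K < 3 ^ d0" using real_arch_pow[of 3 "2 * K"] by auto
  define d where "d = d0 + D + 1"
  have dD: "D < d" by (simp add: d_def)
  have d3: "2 * K \<le> 3 ^ d"
    using power_increasing[of d0 d "3::real"] d0 by (simp add: d_def)
  obtain a1 where a1: "\<And>a j. a \<ge> a1 \<Longrightarrow> j \<ge> 1 \<Longrightarrow> 2 * real j ^ d \<le> M j * (1 + 2 / real j) ^ a"
    using power_le_M_factor[of 2 d] by auto
  obtain a2 where a2: "\<And>a j. a \<ge> a2 \<Longrightarrow> j \<ge> 1 \<Longrightarrow> (2 * K) * real j ^ D \<le> M j * (1 + 2 / real j) ^ a"
    using power_le_M_factor[of "2 * K" D] K1 by auto
  define a where "a = max (D + 1) (max a1 a2)"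
  have aD: "a > D" and ad: "\<And>j. j \<ge> 1 \<Longrightarrow> 2 * real j ^ d \<le> M j * (1 + 2 / real j) ^ a"
    and aK: "\<And>j. j \<ge> 1 \<Longrightarrow> (2 * K) * real j ^ D \<le> M j * (1 + 2 / real j) ^ a"
    using a1[of a] a2[of a] by (auto simp: a_def)
  obtain \<delta>0 where \<delta>0: "\<delta>0 > 0" "\<And>j. j \<ge> 1 \<Longrightarrow> \<delta>0 * real j ^ (a + D) \<le> M j"
    using power_le_M_const by blast
  define \<delta> where "\<delta> = \<epsilon> * \<delta>0"
  have \<delta>: "\<delta> > 0" "\<And>j. j \<ge> 1 \<Longrightarrow> \<delta> * real j ^ (a + D) \<le> \<epsilon> * M j"
    using \<delta>0 eps by (auto simp: \<delta>_def mult.assoc)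
  define C where "C = (\<Sum>n\<le>D. N 1 (poly (\<tau> n)))"
  have \<tau>_C: "N 1 (poly (\<tau> n)) \<le> C" if "n \<le> D" for n
    unfolding C_def using that by (intro member_le_sum) (auto intro: N_nonneg)
  have C0: "C \<ge> 0" unfolding C_def by (intro sum_nonneg N_nonneg) auto
  obtain R where R: "2 / \<delta> * (C + 1) * K\<^sup>2 < 2 ^ R"
    using real_arch_pow[of 2] by auto

  \<comment> \<open>Since \<open>n \<le> D < d\<close>, the index \<open>q = a + n + i d\<close> determines \<open>n\<close> and \<open>i\<close> by division with remainder.\<close>
  define G where "G q =
    (let n = (q - a) mod d; i = (q - a) div d in
     if q \<le> D then A q + monom (of_real \<delta>) (a + q)
     else if a \<le> q \<and> n \<le> D \<and> i < R then monom 1 (a + n + Suc i * d) - monom 1 a * P n (Suc i)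
     else if a \<le> q \<and> n \<le> D \<and> i = R then
       smult (1 / of_real \<delta>) (\<tau> n - P n (Suc (Suc R))) - monom 1 a * P n (Suc R)
     else 0)" for q
  have divmod: "(a + n + i * d - a) mod d = n" "(a + n + i * d - a) div d = i" if "n \<le> D" for n i
    using that dD by auto
  have G_start: "G n = A n + monom (of_real \<delta>) (a + n)" if "n \<le> D" for n
    using that by (simp add: G_def Let_def)
  have G_step: "G (a + n + i * d) = monom 1 (a + n + Suc i * d) - monom 1 a * P n (Suc i)"
    if "n \<le> D" "i < R" for n i
    unfolding G_def Let_def divmod[OF that(1)] using that aD by simp
  have G_end: "G (a + n + R * d) =
      smult (1 / of_real \<delta>) (\<tau> n - P n (Suc (Suc R))) - monom 1 a * P n (Suc R)"
    if "n \<le> D" for n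
    unfolding G_def Let_def divmod[OF that(1)] using that aD by simp

  have G_low: "apply_rows G p = apply_rows A p + smult (of_real \<delta>) (monom 1 a * p)"
    if "degree p \<le> D" for p
  proof -
    have "apply_rows G p = (\<Sum>n\<le>D. smult (coeff p n) (A n) +
        smult (of_real \<delta>) (monom 1 a * monom (coeff p n) n))"
      unfolding apply_rows_cutoff[OF that]
      by (intro sum.cong) (auto simp: G_start smult_add_right mult_monom smult_monom mult.commute)
    also have "\<dots> = apply_rows A p + smult (of_real \<delta>) (monom 1 a * (\<Sum>n\<le>D. monom (coeff p n) n))"
      unfolding apply_rows_cutoff[OF that] sum.distrib
      by (simp add: sum_distrib_left poly_eq_iff coeff_sum)
    finally show ?thesis by (simp add: poly_as_sum_of_monoms'[OF that])
  qed

  have iter: "(apply_rows G ^^ Suc i) (monom 1 n) = P n (Suc i) + monom (of_real \<delta>) (a + n + i * d)"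
    if n: "n \<le> D" and "i \<le> R" for n i
    using that(2)
  proof (induction i)
    case 0
    then show ?case using n by (simp add: P_def apply_rows_monom G_start)
  next
    case (Suc i)
    then have "(apply_rows G ^^ Suc (Suc i)) (monom 1 n)
        = apply_rows G (P n (Suc i)) + apply_rows G (monom (of_real \<delta>) (a + n + i * d))"
      by (simp add: apply_rows_add)
    also have "\<dots> = P n (Suc (Suc i)) + monom (of_real \<delta>) (a + n + Suc i * d)"
      using Suc.prems n
      by (simp add: G_low[OF P_deg[OF n]] apply_rows_monom G_step smult_diff_right smult_monom)
         (simp add: P_def)
    finally show ?case .
  qed
  have final: "(apply_rows G ^^ Suc (Suc R)) (monom 1 n) = \<tau> n" if n: "n \<le> D" for n
  proof -
    have "(apply_rows G ^^ Suc (Suc R)) (monom 1 n)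
        = apply_rows G (P n (Suc R)) + apply_rows G (monom (of_real \<delta>) (a + n + R * d))"
      using iter[OF n order_refl] by (simp add: apply_rows_add)
    also have "\<dots> = \<tau> n"
      using \<delta>(1) by (simp add: G_low[OF P_deg[OF n]] apply_rows_monom G_end n smult_diff_right)
         (simp add: P_def)
    finally show ?thesis .
  qed

  have bound: "N j (poly (G q)) \<le> M j * real (k j) ^ q" if j: "j \<ge> 1" for q j
  proof -
    define x where "x = real j"
    define y where "y = real (k j)"
    have x: "x \<ge> 1" and y: "y \<ge> x + 2" "y \<ge> 3" and M: "M j \<ge> 1"
      using j k_ge[OF j] M_ge_1[OF j] by (auto simp: x_def y_def)
    have ad': "2 * x ^ d \<le> M j * (1 + 2 / x) ^ a" and aK': "(2 * K) * x ^ D \<le> M j * (1 + 2 / x) ^ a"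
      using ad[OF j] aK[OF j] by (simp_all add: x_def)
    have ya: "x ^ a * (1 + 2 / x) ^ a \<le> y ^ a"
    proof -
      have "x * (1 + 2 / x) = x + 2" using x by (simp add: field_simps)
      then show ?thesis
        unfolding power_mult_distrib[symmetric] using x y by (simp add: power_mono)
    qed
    have y3: "(2 * K) ^ i \<le> y ^ (i * d)" for i
    proof -
      have "(2 * K) ^ i \<le> (3 ^ d) ^ i" using K1 d3 by (intro power_mono) auto
      also have "\<dots> = 3 ^ (i * d)" by (simp add: power_mult mult.commute)
      also have "\<dots> \<le> y ^ (i * d)" using y by (intro power_mono) auto
      finally show ?thesis .
    qed
    \<comment> \<open>The two summands of a row get half of the permitted norm each.\<close>
    have climb: "2 * x ^ (a + n + Suc i * d) \<le> M j * y ^ (a + n + i * d)" for n i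
    proof -
      have "2 * x ^ (a + n + Suc i * d) = (2 * x ^ d) * x ^ a * x ^ (n + i * d)"
        by (simp add: power_add mult_ac)
      also have "\<dots> \<le> (M j * (1 + 2 / x) ^ a) * x ^ a * y ^ (n + i * d)"
        by (rule mult_mono[OF mult_right_mono[OF ad'] power_mono]) (use x y M in auto)
      also have "\<dots> = M j * (x ^ a * (1 + 2 / x) ^ a) * y ^ (n + i * d)" by (simp add: mult_ac)
      also have "\<dots> \<le> M j * y ^ a * y ^ (n + i * d)"
        by (rule mult_right_mono[OF mult_left_mono[OF ya]]) (use x y M in auto)
      finally show ?thesis by (simp add: power_add mult_ac)
    qed
    have correct: "2 * N j (poly (monom 1 a * P n (Suc i))) \<le> M j * y ^ (a + n + i * d)"
      if n: "n \<le> D" for n i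
    proof -
      have "2 * N j (poly (monom 1 a * P n (Suc i))) \<le> 2 * (x ^ a * (x ^ D * K ^ Suc i))"
        unfolding x_def using j
        by (intro mult_left_mono order_trans[OF N_poly_shift] N_poly_degree[OF P_deg[OF n] j P_K[OF n]]) auto
      also have "\<dots> = ((2 * K) * x ^ D) * x ^ a * (1 * K ^ i)" by (simp add: mult_ac)
      also have "\<dots> \<le> (M j * (1 + 2 / x) ^ a) * x ^ a * (y ^ n * (2 * K) ^ i)"
      proof (rule mult_mono[OF mult_right_mono[OF aK']])
        show "1 * K ^ i \<le> y ^ n * (2 * K) ^ i"
          by (rule mult_mono[OF one_le_power power_mono]) (use y K1 in auto)
      qed (use x M K1 in auto)
      also have "\<dots> = M j * (x ^ a * (1 + 2 / x) ^ a) * (y ^ n * (2 * K) ^ i)" by (simp add: mult_ac)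
      also have "\<dots> \<le> M j * y ^ a * (y ^ n * y ^ (i * d))"
        by (rule mult_mono[OF mult_left_mono[OF ya] mult_left_mono[OF y3]]) (use x y M K1 in auto)
      finally show ?thesis by (simp add: power_add mult_ac)
    qed
    consider (low) "q \<le> D" | (step) n i where "n \<le> D" "i < R" "q = a + n + i * d"
      | (last) n where "n \<le> D" "q = a + n + R * d" | (zero) "G q = 0"
    proof (cases "q \<le> D")
      case False
      have q: "q = a + (q - a) mod d + (q - a) div d * d" if "a \<le> q"
        using that by simp
      show ?thesis
      proof (cases "a \<le> q \<and> (q - a) mod d \<le> D \<and> (q - a) div d \<le> R")
        case True
        then show ?thesis using that(2)[OF _ _ q] that(3) q by (metis le_neq_implies_less)
      next
        case False
        then have "G q = 0" using \<open>\<not> q \<le> D\<close> by (auto simp: G_def Let_def)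
        then show ?thesis by (rule that(4))
      qed
    qed (rule that(1))
    then show ?thesis
    proof cases
      case low
      have "N j (poly (G q)) \<le> N j (poly (A q)) + \<delta> * x ^ (a + q)"
        unfolding G_start[OF low] x_def using \<delta>(1)
        by (intro order_trans[OF N_poly_add]) (simp add: N_poly_monom)
      also have "\<delta> * x ^ (a + q) \<le> \<delta> * x ^ (a + D)"
        using \<delta>(1) x low by (intro mult_left_mono power_increasing) auto
      also have "\<dots> \<le> \<epsilon> * (M j * 1)" using \<delta>(2)[OF j] by (simp add: x_def)
      also have "\<dots> \<le> \<epsilon> * (M j * y ^ q)"
        using eps M y by (intro mult_left_mono one_le_power) auto
      also have "N j (poly (A q)) \<le> (1 - \<epsilon>) * (M j * y ^ q)"
        using A_bound[OF low j] by (simp add: y_def)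
      finally show ?thesis by (simp add: y_def algebra_simps)
    next
      case step
      have "N j (poly (G q)) \<le> x ^ (a + n + Suc i * d) + N j (poly (monom 1 a * P n (Suc i)))"
        unfolding step(3) G_step[OF step(1,2)] x_def
        by (intro order_trans[OF N_poly_diff]) (simp add: N_poly_monom)
      then show ?thesis
        using climb[of n i] correct[OF step(1), of i] unfolding step(3) y_def by linarith
    next
      case last
      have "2 * N j (poly (smult (1 / of_real \<delta>) (\<tau> n - P n (Suc (Suc R))))) \<le> M j * y ^ q"
      proof -
        have "N j (poly (\<tau> n - P n (Suc (Suc R)))) \<le> x ^ D * C + x ^ D * K ^ Suc (Suc R)"
          unfolding x_def using j last(1)
          by (intro order_trans[OF N_poly_diff] add_mono N_poly_degree P_deg \<tau>_deg P_K \<tau>_C)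
        also have "\<dots> = x ^ D * (C * 1 + K ^ Suc (Suc R))" by (simp add: algebra_simps)
        also have "\<dots> \<le> x ^ D * (C * K ^ Suc (Suc R) + K ^ Suc (Suc R))"
          using x C0 K1 by (intro mult_left_mono add_right_mono one_le_power) auto
        finally have "2 * N j (poly (smult (1 / of_real \<delta>) (\<tau> n - P n (Suc (Suc R)))))
            \<le> 2 * (1 / \<delta> * (x ^ D * (C * K ^ Suc (Suc R) + K ^ Suc (Suc R))))"
          using \<delta>(1) by (simp add: N_poly_smult norm_divide divide_right_mono)
        also have "\<dots> = x ^ D * K ^ R * (2 / \<delta> * (C + 1) * K\<^sup>2)"
          by (simp add: power2_eq_square algebra_simps add_divide_distrib)
        also have "\<dots> \<le> x ^ D * K ^ R * 2 ^ R"
          using R x K1 by (intro mult_left_mono) auto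
        also have "\<dots> = 1 * (x ^ D * (2 * K) ^ R)" by (simp add: power_mult_distrib mult_ac)
        also have "\<dots> \<le> M j * (y ^ (a + n) * y ^ (R * d))"
        proof (intro mult_mono M y3)
          have "x ^ D \<le> y ^ D" using x y by (intro power_mono) auto
          also have "\<dots> \<le> y ^ (a + n)" using y aD by (intro power_increasing) auto
          finally show "x ^ D \<le> y ^ (a + n)" .
        qed (use x y K1 M in auto)
        finally show ?thesis by (simp add: last(2) power_add mult_ac)
      qed
      moreover have "N j (poly (G q)) \<le> N j (poly (smult (1 / of_real \<delta>) (\<tau> n - P n (Suc (Suc R)))))
          + N j (poly (monom 1 a * P n (Suc R)))"
        unfolding last(2) G_end[OF last(1)] by (rule N_poly_diff)
      ultimately show ?thesis
        using correct[OF last(1), of R] unfolding last(2) y_def by linarith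
    next
      case zero
      then show ?thesis using M by (simp add: N_poly[of 0 0])
    qed
  qed

  have "(\<lambda>q. coeff (G q)) \<in> matrices M k"
    using matricesI[of "\<lambda>q. poly (G q)" M k] bound by (simp add: taylor_poly)
  moreover have "coeff (G n) l = coeff (A n) l" if "n \<le> D" "l \<le> D" for n l
    using that aD by (simp add: G_start)
  ultimately show ?thesis using final by blast
qed

text \<open>
  Truncating the rows of \<open>c\<close> preserves their bounds, and the factor \<open>1 - \<epsilon>\<close> provides the slack that
  the construction asks for.
\<close>

lemma matrices_approx:
  assumes c: "c \<in> matrices M k" and eps: "0 < \<epsilon>" "\<epsilon> \<le> 1"
    and \<tau>_deg: "\<And>n. n \<le> D \<Longrightarrow> degree (\<tau> n) \<le> D"
  shows "\<exists>b\<in>matrices M k. (\<forall>n\<le>D. \<forall>l\<le>D. b n l = of_real (1 - \<epsilon>) * c n l) \<and>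
    (\<exists>T. \<forall>n\<le>D. (operator_of b ^^ T) (\<lambda>z. z ^ n) = poly (\<tau> n))"
proof -
  define A where "A n = (\<Sum>l\<le>D. monom (of_real (1 - \<epsilon>) * c n l) l)" for n
  have coeff_A: "coeff (A n) l = (if l \<le> D then of_real (1 - \<epsilon>) * c n l else 0)" for n l
    by (simp add: A_def coeff_sum)
  have deg: "degree (A n) \<le> D" for n
    by (rule degree_le) (simp add: coeff_A)
  have A_bound: "N j (poly (A n)) \<le> (1 - \<epsilon>) * (M j * real (k j) ^ n)" if "j \<ge> 1" for n j
  proof -
    have "N j (poly (A n)) = (\<Sum>l\<le>D. (1 - \<epsilon>) * (norm (c n l) * real j ^ l))"
      unfolding N_poly[OF deg] using eps by (intro sum.cong) (auto simp: coeff_A norm_mult simp del: of_real_diff)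
    also have "\<dots> = (1 - \<epsilon>) * (\<Sum>l<Suc D. norm (c n l) * real j ^ l)"
      by (simp add: sum_distrib_left lessThan_Suc_atMost del: sum.lessThan_Suc)
    also have "\<dots> \<le> (1 - \<epsilon>) * (M j * real (k j) ^ n)"
    proof (rule mult_left_mono)
      show "(\<Sum>l<Suc D. norm (c n l) * real j ^ l) \<le> M j * real (k j) ^ n"
        using c that unfolding matrices_def by blast
    qed (use eps in simp)
    finally show ?thesis .
  qed
  have "\<exists>G T. (\<lambda>q. coeff (G q)) \<in> matrices M k \<and>
      (\<forall>n\<le>D. \<forall>l\<le>D. coeff (G n) l = coeff (A n) l) \<and>
      (\<forall>n\<le>D. (apply_rows G ^^ T) (monom 1 n) = \<tau> n)"
    by (rule ex_matrix_steering_monomials[OF eps(1) deg A_bound \<tau>_deg])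
  then obtain G T where "(\<lambda>q. coeff (G q)) \<in> matrices M k \<and>
      (\<forall>n\<le>D. \<forall>l\<le>D. coeff (G n) l = coeff (A n) l) \<and>
      (\<forall>n\<le>D. (apply_rows G ^^ T) (monom 1 n) = \<tau> n)"
    by (elim exE) rule
  then have G: "(\<lambda>q. coeff (G q)) \<in> matrices M k"
    "\<And>n l. n \<le> D \<Longrightarrow> l \<le> D \<Longrightarrow> coeff (G n) l = coeff (A n) l"
    "\<And>n. n \<le> D \<Longrightarrow> (apply_rows G ^^ T) (monom 1 n) = \<tau> n" by blast+
  have "(operator_of (\<lambda>q. coeff (G q)) ^^ T) (\<lambda>z. z ^ n) = poly (\<tau> n)" if "n \<le> D" for n
  proof -
    have "(\<lambda>z :: complex. z ^ n) = poly (monom 1 n)" by (simp add: fun_eq_iff poly_monom)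
    then show ?thesis by (simp only: operator_of_iter_poly[OF G(1)] G(3)[OF that])
  qed
  moreover have "coeff (G n) l = of_real (1 - \<epsilon>) * c n l" if "n \<le> D" "l \<le> D" for n l
    using G(2)[OF that] that by (simp only: coeff_A if_True)
  ultimately show ?thesis by (intro bexI[OF _ G(1)]) blast
qed

end

section \<open>From open dense conditions to hypercyclic algebras\<close>

text \<open>
  As \<open>N\<^sub>j\<close> increases with \<open>j\<close>, a single index \<open>s\<close> can serve both as seminorm and as precision.
\<close>

definition hitting_matrices :: "(nat \<Rightarrow> real) \<Rightarrow> (nat \<Rightarrow> nat) \<Rightarrow> nat \<Rightarrow> complex poly \<Rightarrow> nat \<Rightarrow> (nat \<Rightarrow> nat \<Rightarrow> complex) set" where
  "hitting_matrices M k m v s = {c \<in> matrices M k. \<exists>T. \<forall>n\<in>{1..m}.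
     N (Suc s) (\<lambda>z. (operator_of c ^^ T) (\<lambda>z. z ^ n) z - poly (if n = m then v else 0) z) < 1 / real (Suc s)}"

lemma openin_hitting_matrices:
  assumes "m \<ge> 1" shows "openin (top_of_set (matrices M k)) (hitting_matrices M k m v s)"
proof -
  define B where "B n T = {c \<in> matrices M k. (operator_of c ^^ T) (\<lambda>z. z ^ n) \<in>
      {g \<in> entire. N (Suc s) (\<lambda>z. g z - poly (if n = m then v else 0) z) < 1 / real (Suc s)}}" for n T
  have "openin (top_of_set (matrices M k)) (B n T)" for n T
    unfolding B_def
    by (rule openin_matrices_vimage[OF _ _ openin_N_ball])
       (rule operator_of_iter_entire operator_of_iter_tendsto entire_power entire_poly | assumption | simp)+
  then have "openin (top_of_set (matrices M k)) (\<Union>T. \<Inter>n\<in>{1..m}. B n T)"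
    using assms by (intro openin_Union openin_INT2 ballI) auto
  also have "(\<Union>T. \<Inter>n\<in>{1..m}. B n T) = hitting_matrices M k m v s"
    using assms operator_of_iter_entire[of _ M k] by (fastforce simp: B_def hitting_matrices_def)
  finally show ?thesis .
qed

text \<open>
  For \<open>D \<rightarrow> \<infinity>\<close> and \<open>\<epsilon> \<rightarrow> 0\<close> the matrices of \<open>matrices_approx\<close> converge entrywise to the given one, and
  each of them hits the target exactly.
\<close>

lemma (in fast_weights) dense_hitting_matrices:
  "top_of_set (matrices M k) closure_of (hitting_matrices M k m v s) = matrices M k"
proof (intro subset_antisym subsetI)
  fix c assume c: "c \<in> matrices M k"
  define D where "D t = t + m + degree v" for t
  have "\<exists>b\<in>matrices M k. (\<forall>n\<le>D t. \<forall>l\<le>D t. b n l = of_real (1 - 1 / real (Suc t)) * c n l) \<and>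
      (\<exists>T. \<forall>n\<le>D t. (operator_of b ^^ T) (\<lambda>z. z ^ n) = poly (if n = m then v else 0))" for t
    by (rule matrices_approx[OF c]) (auto simp: D_def)
  then obtain b T where b: "\<And>t. b t \<in> matrices M k"
    "\<And>t n l. n \<le> D t \<Longrightarrow> l \<le> D t \<Longrightarrow> b t n l = of_real (1 - 1 / real (Suc t)) * c n l"
    "\<And>t n. n \<le> D t \<Longrightarrow> (operator_of (b t) ^^ T t) (\<lambda>z. z ^ n) = poly (if n = m then v else 0)"
    by metis
  have "b t \<in> hitting_matrices M k m v s" for t
    unfolding hitting_matrices_def using b(1)[of t] b(3)[where t = t]
    by (intro CollectI conjI exI[of _ "T t"]) (auto simp: D_def)
  moreover have "b \<longlonglongrightarrow> c"
  proof -
    have "(\<lambda>t. b t n l) \<longlonglongrightarrow> c n l" for n l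
    proof (rule Lim_transform_eventually)
      have "(\<lambda>t. of_real (1 - 1 / real (Suc t)) * c n l) \<longlonglongrightarrow> of_real (1 - 0) * c n l"
        by (intro tendsto_intros LIMSEQ_Suc lim_1_over_n)
      then show "(\<lambda>t. of_real (1 - 1 / real (Suc t)) * c n l) \<longlonglongrightarrow> c n l" by simp
      show "\<forall>\<^sub>F t in sequentially. of_real (1 - 1 / real (Suc t)) * c n l = b t n l"
        using eventually_ge_at_top[of "max n l"] by eventually_elim (simp add: b(2) D_def)
    qed
    then have "limitin (product_topology (\<lambda>_. product_topology (\<lambda>_. euclidean) UNIV) UNIV) b c sequentially"
      by (simp add: limitin_componentwise)
    then show ?thesis by (simp add: euclidean_product_topology)
  qed
  ultimately have "c \<in> closure (hitting_matrices M k m v s)" unfolding closure_sequential by blast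
  moreover have "matrices M k \<inter> hitting_matrices M k m v s = hitting_matrices M k m v s" by (auto simp: hitting_matrices_def)
  ultimately show "c \<in> top_of_set (matrices M k) closure_of (hitting_matrices M k m v s)"
    using c by (simp add: closure_of_subtopology)
qed (auto simp: closure_of_subtopology)

text \<open>
  To bring the orbit of \<open>p\<close> near \<open>f\<close>, aim with \<open>z\<^sup>m\<close>, \<open>m = degree p\<close>, at \<open>f\<close> divided by the leading
  coefficient of \<open>p\<close>. The errors of all powers are multiplied by the coefficients of \<open>p\<close>, which
  are fixed before the precision is chosen.
\<close>

lemma hypercyclic_algebra_if_hitting:
  assumes c: "c \<in> matrices M k"
    and Q: "\<And>f j e. f \<in> entire \<Longrightarrow> j \<ge> 1 \<Longrightarrow> e > 0 \<Longrightarrow> \<exists>p\<in>Q. N j (\<lambda>z. poly p z - f z) < e"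
    and hits: "\<And>m v s. m \<ge> 1 \<Longrightarrow> v \<in> Q \<Longrightarrow> c \<in> hitting_matrices M k m v s"
  shows "admits_hypercyclic_algebra (operator_of c)"
proof -
  define A where "A = poly ` {p :: complex poly. coeff p 0 = 0}"
  have "entire_subalgebra A"
    unfolding entire_subalgebra_def
  proof (intro conjI ballI allI)
    show "A \<subseteq> entire" by (auto simp: A_def)
    show "(\<lambda>z. 0) \<in> A" unfolding A_def by (rule image_eqI[of _ _ 0]) auto
    fix f assume "f \<in> A"
    then obtain p where p: "f = poly p" "coeff p 0 = 0" by (auto simp: A_def)
    show "(\<lambda>z. a * f z) \<in> A" for a
      unfolding A_def by (rule image_eqI[of _ _ "smult a p"]) (use p in auto)
    fix g assume "g \<in> A"
    then obtain q where q: "g = poly q" "coeff q 0 = 0" by (auto simp: A_def)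
    show "(\<lambda>z. f z + g z) \<in> A"
      unfolding A_def by (rule image_eqI[of _ _ "p + q"]) (use p q in auto)
    show "(\<lambda>z. f z * g z) \<in> A"
      unfolding A_def by (rule image_eqI[of _ _ "p * q"]) (use p q in \<open>auto simp: coeff_mult_0\<close>)
  qed
  moreover have "A \<noteq> {\<lambda>z. 0}"
  proof
    assume "A = {\<lambda>z. 0}"
    moreover have "poly (monom 1 1) \<in> A" by (auto simp: A_def)
    ultimately have "poly (monom 1 1) (1 :: complex) = 0" by simp
    then show False by (simp add: poly_monom)
  qed
  moreover have "poly p \<in> hypercyclic_vectors entire_topology (operator_of c)"
    if p: "coeff p 0 = 0" "p \<noteq> 0" for p
  proof -
    define m where "m = degree p"
    have m: "m \<ge> 1" using p unfolding m_def by (metis One_nat_def Suc_leI leading_coeff_0_iff neq0_conv)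
    define lc where "lc = coeff p m"
    have lc: "lc \<noteq> 0" using p by (simp add: lc_def m_def)
    define S where "S = (\<Sum>i\<in>{1..m}. norm (coeff p i))"
    have S: "S \<ge> 0" by (simp add: S_def sum_nonneg)
    have p_sum: "poly p = (\<lambda>z. \<Sum>i\<in>{1..m}. coeff p i * z ^ i)"
    proof
      fix z
      have "poly p z = (\<Sum>i\<le>m. coeff p i * z ^ i)" by (simp add: poly_altdef m_def)
      also have "\<dots> = (\<Sum>i\<in>{1..m}. coeff p i * z ^ i)"
        by (rule sum.mono_neutral_right) (use p in \<open>auto simp: not_less_eq_eq\<close>)
      finally show "poly p z = (\<Sum>i\<in>{1..m}. coeff p i * z ^ i)" .
    qed
    have "\<exists>g\<in>range (\<lambda>n. (operator_of c ^^ n) (poly p)). N j (\<lambda>z. g z - f z) < e"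
      if f: "f \<in> entire" and j: "j \<ge> 1" and e: "e > 0" for f j e
    proof -
      have f': "(\<lambda>z. inverse lc * f z) \<in> entire" using f by auto
      obtain v where v: "v \<in> Q" "N j (\<lambda>z. poly v z - inverse lc * f z) < e / (2 * norm lc)"
        using Q[OF f' j, of "e / (2 * norm lc)"] e lc by auto
      obtain s0 where s0: "2 * S / e < real s0" using reals_Archimedean2 by blast
      define s where "s = max s0 j"
      have s: "S * (1 / real (Suc s)) < e / 2" "j \<le> Suc s"
      proof -
        have "2 * S < e * real s0" using s0 e by (simp add: field_simps)
        also have "\<dots> \<le> e * real (Suc s)" using e by (intro mult_left_mono) (auto simp: s_def)
        finally show "S * (1 / real (Suc s)) < e / 2" by (simp add: field_simps)
      qed (simp add: s_def)
      have "\<exists>T. \<forall>n\<in>{1..m}. N (Suc s) (\<lambda>z. (operator_of c ^^ T) (\<lambda>z. z ^ n) z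
          - poly (if n = m then v else 0) z) < 1 / real (Suc s)"
        using hits[OF m v(1), of s] by (simp only: hitting_matrices_def mem_Collect_eq)
      then obtain T where T: "\<And>n. n \<in> {1..m} \<Longrightarrow> N (Suc s) (\<lambda>z. (operator_of c ^^ T) (\<lambda>z. z ^ n) z
          - poly (if n = m then v else 0) z) < 1 / real (Suc s)"
        by blast
      define h where "h i = (\<lambda>z. (operator_of c ^^ T) (\<lambda>z. z ^ i) z - poly (if i = m then v else 0) z)" for i
      have h: "h i \<in> entire" for i
        unfolding h_def by (intro entire_diff operator_of_iter_entire[OF c] entire_power entire_poly)
      have "(\<lambda>z. (operator_of c ^^ T) (poly p) z - f z)
          = (\<lambda>z. (\<Sum>i\<in>{1..m}. coeff p i * h i z) + lc * (poly v z - inverse lc * f z))"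
      proof
        fix z
        have "(\<Sum>i\<in>{1..m}. coeff p i * poly (if i = m then v else 0) z)
            = (\<Sum>i\<in>{1..m}. if i = m then lc * poly v z else 0)"
          by (intro sum.cong) (auto simp: lc_def)
        then have "(\<Sum>i\<in>{1..m}. coeff p i * poly (if i = m then v else 0) z) = lc * poly v z"
          using m by simp
        moreover have "(operator_of c ^^ T) (poly p) z
            = (\<Sum>i\<in>{1..m}. coeff p i * (operator_of c ^^ T) (\<lambda>z. z ^ i) z)"
          unfolding p_sum by (subst operator_of_iter_sum[OF c]) auto
        ultimately show "(operator_of c ^^ T) (poly p) z - f z
            = (\<Sum>i\<in>{1..m}. coeff p i * h i z) + lc * (poly v z - inverse lc * f z)"
          using lc by (simp add: h_def right_diff_distrib sum_subtractf mult.assoc[symmetric])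
      qed
      then have "N j (\<lambda>z. (operator_of c ^^ T) (poly p) z - f z)
          \<le> N j (\<lambda>z. \<Sum>i\<in>{1..m}. coeff p i * h i z) + N j (\<lambda>z. lc * (poly v z - inverse lc * f z))"
        using h f by (simp only:) (intro N_add entire_sum entire_cmult entire_diff entire_poly; simp)
      also have "N j (\<lambda>z. \<Sum>i\<in>{1..m}. coeff p i * h i z) \<le> (\<Sum>i\<in>{1..m}. norm (coeff p i) * N j (h i))"
        by (rule order_trans[OF N_sum]) (auto simp: N_cmult h entire_cmult)
      also have "\<dots> \<le> (\<Sum>i\<in>{1..m}. norm (coeff p i) * (1 / real (Suc s)))"
        using order_trans[OF N_mono[OF h s(2)] less_imp_le[OF T[folded h_def]]]
        by (intro sum_mono mult_left_mono) auto
      also have "\<dots> = S * (1 / real (Suc s))" unfolding S_def sum_distrib_right ..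
      also have "\<dots> < e / 2" by (rule s(1))
      also have "N j (\<lambda>z. lc * (poly v z - inverse lc * f z)) < e / 2"
        using v(2) lc unfolding N_cmult[OF entire_diff[OF entire_poly f']] by (simp add: field_simps)
      finally have "N j (\<lambda>z. (operator_of c ^^ T) (poly p) z - f z) < e" by simp
      then show ?thesis by blast
    qed
    then have "entire_topology closure_of range (\<lambda>n. (operator_of c ^^ n) (poly p)) = topspace entire_topology"
      by (intro closure_of_entire_eqI) (auto intro: operator_of_iter_entire[OF c])
    then show ?thesis by (simp add: hypercyclic_vectors_def)
  qed
  then have "A \<subseteq> hypercyclic_vectors entire_topology (operator_of c) \<union> {\<lambda>z. 0}"
    by (force simp: A_def)
  ultimately show ?thesis unfolding admits_hypercyclic_algebra_def by blast
qed

theorem theorem1p1: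
  fixes M :: "nat \<Rightarrow> real" and k :: "nat \<Rightarrow> nat"
  assumes M_pos: "\<And>j. j \<ge> 1 \<Longrightarrow> M j > 0"
    and k_pos: "\<And>j. j \<ge> 1 \<Longrightarrow> k j > 0"
    and M_growth: "\<And>\<alpha>::real. \<alpha> \<ge> 1 \<Longrightarrow> (\<lambda>j. real j powr \<alpha>) \<in> o(M)"
    and M_ge: "\<And>j. j \<ge> 1 \<Longrightarrow> M j \<ge> real j + 1"
    and k_ge: "\<And>j. j \<ge> 1 \<Longrightarrow> k j \<ge> j + 2"
    and M1_less: "M 1 < real (k 1)"
    and k_ge_k1: "\<And>j. j \<ge> 1 \<Longrightarrow> k j \<ge> k 1"
  shows "typical_in (operator_space M k) admits_hypercyclic_algebra"
proof -
  interpret fast_weights M k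
  proof
    show "M j \<ge> 1" if "j \<ge> 1" for j using M_ge[OF that] by simp
  qed (fact M_growth k_ge)+
  obtain Q where Q: "countable Q"
    "\<And>f j e. f \<in> entire \<Longrightarrow> j \<ge> 1 \<Longrightarrow> e > 0 \<Longrightarrow> \<exists>p\<in>Q. N j (\<lambda>z. poly p z - f z) < e"
    using countable_dense_polynomials by blast
  define H where "H = (\<lambda>(m, v, s). hitting_matrices M k m v s) ` ({1..} \<times> Q \<times> UNIV)"
  have H_count: "countable H" unfolding H_def using Q(1) by auto
  have H_open: "openin (top_of_set (matrices M k)) B" if "B \<in> H" for B
    using that by (auto simp: H_def intro: openin_hitting_matrices)
  have H_dense: "top_of_set (matrices M k) closure_of B = matrices M k" if "B \<in> H" for B
    using that dense_hitting_matrices by (auto simp: H_def)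
  obtain p0 where "p0 \<in> Q" using Q(2)[of "\<lambda>z. 0" 1 1] by auto
  then have H_ne: "hitting_matrices M k 1 p0 0 \<in> H" unfolding H_def by (intro image_eqI[of _ _ "(1, p0, 0)"]) auto
  have "completely_metrizable_space (top_of_set (matrices M k))"
    by (rule completely_metrizable_space_closedin[OF completely_metrizable_space_euclidean])
       (simp add: closed_matrices)
  then have dense: "top_of_set (matrices M k) closure_of \<Inter>H = matrices M k"
    using Baire_category[OF _ H_count, of "top_of_set (matrices M k)"] H_open H_dense by auto

  \<comment> \<open>Openness is transferred to the operators by \<open>matrix_of\<close>, and density by \<open>operator_of\<close>.\<close>
  define pre where "pre B = {T \<in> topspace (operator_space M k). matrix_of T \<in> B}" for B
  define G where "G = \<Inter>(pre ` H)"
  have "gdelta_in (operator_space M k) G"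
    unfolding G_def
  proof (rule gdelta_in_Inter)
    show "gdelta_in (operator_space M k) B" if "B \<in> pre ` H" for B
      using that H_open continuous_map_matrix_of[of M k]
      unfolding pre_def continuous_map_def by (auto intro!: open_imp_gdelta_in)
  qed (use H_count H_ne in auto)
  moreover have "operator_space M k closure_of G = topspace (operator_space M k)"
  proof (intro subset_antisym closure_of_subset_topspace subsetI)
    fix T assume "T \<in> topspace (operator_space M k)"
    then have T: "T \<in> operators M k" by simp
    have "matrix_of T \<in> top_of_set (matrices M k) closure_of \<Inter>H"
      unfolding dense by (rule matrix_of_in_matrices[OF T])
    then have "operator_of (matrix_of T) \<in> operator_space M k closure_of (operator_of ` \<Inter>H)"
      using continuous_map_image_closure_subset[OF continuous_map_operator_of] by blast
    moreover have "operator_of ` \<Inter>H \<subseteq> G"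
    proof
      fix S assume "S \<in> operator_of ` \<Inter>H"
      then obtain c where c: "S = operator_of c" "c \<in> \<Inter>H" by auto
      then have "c \<in> matrices M k" using H_ne by (auto simp: hitting_matrices_def)
      then show "S \<in> G"
        using c by (auto simp: G_def pre_def matrix_of_operator_of operator_of_in_operators)
    qed
    ultimately show "T \<in> operator_space M k closure_of G"
      using closure_of_mono operator_of_matrix_of[OF T] by fastforce
  qed
  moreover have "G \<subseteq> {T \<in> topspace (operator_space M k). admits_hypercyclic_algebra T}"
  proof
    fix T assume "T \<in> G"
    then have T: "T \<in> operators M k" "\<And>B. B \<in> H \<Longrightarrow> matrix_of T \<in> B"
      using H_ne by (auto simp: G_def pre_def)
    have "matrix_of T \<in> hitting_matrices M k m v s" if "m \<ge> 1" "v \<in> Q" for m v s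
      using that by (intro T(2)) (auto simp: H_def intro!: image_eqI[of _ _ "(m, v, s)"])
    from hypercyclic_algebra_if_hitting[OF matrix_of_in_matrices[OF T(1)] Q(2) this]
    have "admits_hypercyclic_algebra T" by (simp add: operator_of_matrix_of[OF T(1)])
    then show "T \<in> {T \<in> topspace (operator_space M k). admits_hypercyclic_algebra T}" using T by simp
  qed
  ultimately show ?thesis unfolding typical_in_def comeager_in_def by blast
qed

end
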